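(* Let Assumptions 1, 2 and 3 (recalled in the context) hold. Let $A>0$ and let $(x^k)_k$ be generated by the Stochastic Frank-Wolfe algorithm described in the context, with $n_k\ge\max\big(\frac{Ak^2}{N},1\big)$ for every $k$. Put $\gamma_K=J(x^K)-\mathcal{J}^*$. Then, for all $K=1,\dots,2N$, $$\mathbb{P}\Big[\gamma_K<\frac{4C_1+C_0}{K}\Big]\ \ge\ 1-\exp\Big(-\frac{A}{12}\Big).$$
   Context: Setting. $N,M\ge1$ are integers; $\mathcal{X}_1,\dots,\mathcal{X}_N$ are nonempty sets and $\mathcal{X}=\prod_{i=1}^N\mathcal{X}_i$; $\mathcal{E}_1,\dots,\mathcal{E}_M$ are separable real Hilbert spaces and $\mathcal{E}=\prod_{j=1}^M\mathcal{E}_j$ with scalar product $\langle y,y'\rangle=\sum_j\langle y_j,y_j'\rangle_{\mathcal{E}_j}$. For each $i,j$ we are given maps $g_{ij}:\mathcal{X}_i\to\mathcal{E}_j$ and $f_j:\mathcal{E}_j\to\mathbb{R}$; $g_i=(g_{ij})_{j=1,\dots,M}$, $f(y)=\sum_{j=1}^M f_j(y_j)$, $G(x)=\frac1N\sum_{i=1}^Ng_i(x_i)$, $J(x)=f(G(x))$ for $x\in\mathcal{X}$. Randomized problem. $\mathcal{P}_\delta(\mathcal{X}_i)$ is the set of finitely supported probability measures on $\mathcal{X}_i$, $\mathcal{P}_\delta=\prod_i\mathcal{P}_\delta(\mathcal{X}_i)$, $E_{\mu_i}[g_i]$ is the integral of $g_i$ with respect to $\mu_i$, $\mathcal{J}(\mu)=f\big(\frac1N\sum_{i=1}^NE_{\mu_i}[g_i]\big)$,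 and $\mathcal{J}^*=\inf_{\mu\in\mathcal{P}_\delta}\mathcal{J}(\mu)$. Assumption 1. Let $S_{ij}=g_{ij}(\mathcal{X}_i)$ and $S_j=\frac1N\sum_{i=1}^NS_{ij}$ (Minkowski sum). For all $i,j$: (1) $S_{ij}$ has finite diameter $d_{ij}$; (2) $f_j$ is $L_j$-Lipschitz on $\mathrm{conv}(S_j)$; (3) $f_j$ is continuously differentiable on a neighborhood of $\mathrm{conv}(S_j)$ and $\nabla f_j$ is $\tilde L_j$-Lipschitz on $\mathrm{conv}(S_j)$. Assumption 2. For all $j$, $f_j$ is convex over $\mathrm{conv}(S_j)$. Assumption 3. Let $\mathcal{A}=\{\nabla f(y)\mid y\in\mathrm{conv}(G(\mathcal{X}))\}\subset\mathcal{E}$. For all $i$ and all $\lambda\in\mathcal{A}$, the problem $\inf_{x_i\in\mathcal{X}_i}\langle\lambda,g_i(x_i)\rangle$ has at least one solution; a map $\mathbb{S}_i:\mathcal{A}\to\mathcal{X}_i$ is fixed such that $\mathbb{S}_i(\lambda)$ is a solution of it for every $\lambda\in\mathcal{A}$. Constants (taken positive): $C_0=\sum_{j=1}^M\big(L_j\max_{1\le i\le N}d_{ij}\big)>0$ and $C_1=\frac1N\sum_{j=1}^M\big(\tilde L_j\sum_{i=1}^Nd_{ij}^2\big)>0$. Stochastic Frank-Wolfe algorithm. Let $x^0\in\mathcal{X}$ and let $(n_k)_{k\ge0}$ be a (deterministic) sequence of positive integers. For $k=0,1,2,\dots$: set $y^k=\frac1N\sum_{i=1}^Ng_i(x_i^k)$,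 $\lambda^k=\nabla f(y^k)$, $\bar x_i^k=\mathbb{S}_i(\lambda^k)$ for $i=1,\dots,N$, and $\omega_k=\frac{2}{k+2}$. For $j=1,\dots,n_k$ and $i=1,\dots,N$, draw a Bernoulli random variable $P_i^{k,j}$ with parameter $\omega_k$, all these variables (over all $k,j,i$) being independent, and let $\hat x_i^{k,j}=x_i^k$ if $P_i^{k,j}=0$ and $\hat x_i^{k,j}=\bar x_i^k$ if $P_i^{k,j}=1$; put $\hat x^{k,j}=(\hat x_i^{k,j})_{i=1,\dots,N}$. Let $x^{k+1}$ be a minimizer of $J$ over the finite set $\{\hat x^{k,j}\mid j=1,\dots,n_k\}$ (ties being broken by a deterministic rule depending only on the variables drawn so far, so that $x^{k+1}$ is a function of the $P_i^{k',j}$ with $k'\le k$). *)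

theory Defs
  imports "HOL-Probability.Probability"
begin

text \<open>
  The agents \<open>i\<close> range over a finite type \<open>'n\<close> and the components \<open>j\<close> over a finite type
  \<open>'m\<close>, so that \<open>N = CARD('n)\<close> and \<open>M = CARD('m)\<close>.  The set of agent \<open>i\<close> is \<open>X i :: 'x set\<close>.
  The possibly different separable Hilbert spaces \<open>\<E>\<^sub>j\<close> are closed linear subspaces \<open>E j\<close> of an
  arbitrary separable Hilbert space \<open>'e\<close>; every finite family of separable Hilbert spaces arises
  in this way, e.g. inside its Hilbert sum.  The maps \<open>f j\<close> matter only on \<open>E j\<close> and \<open>g i j\<close>
  only on \<open>X i\<close>.  The product is a subspace of \<open>'e ^ 'm\<close>, whose inner product is the sum of the
  inner products of the components.
\<close>

definition hilbert_subspace :: "'e::{real_inner,banach,second_countable_topology} set \<Rightarrow> bool" where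
  "hilbert_subspace V \<longleftrightarrow> subspace V \<and> closed V"

definition prod_space :: "('m \<Rightarrow> 'e set) \<Rightarrow> ('e ^ 'm::finite) set" where
  "prod_space E = {y. \<forall>j. y $ j \<in> E j}"

text \<open>
  \<open>v\<close> is the gradient (Riesz representative of the Frechet derivative) at \<open>y\<close> of \<open>f\<close> regarded as
  a function on the Hilbert space \<open>V\<close>; the requirement \<open>v \<in> V\<close> makes it unique.  It is
  \<^const>\<open>gderiv\<close> if \<open>V\<close> is the whole space.
\<close>

definition is_gradient :: "'v::real_inner set \<Rightarrow> ('v \<Rightarrow> real) \<Rightarrow> 'v \<Rightarrow> 'v \<Rightarrow> bool" where
  "is_gradient V f y v \<longleftrightarrow> v \<in> V \<and> (f has_derivative (\<lambda>h. inner h v)) (at y within V)"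

definition gradient :: "'v::real_inner set \<Rightarrow> ('v \<Rightarrow> real) \<Rightarrow> 'v \<Rightarrow> 'v" where
  "gradient V f y = (THE v. is_gradient V f y v)"

definition C1_on_nbhd :: "'v::real_inner set \<Rightarrow> 'v set \<Rightarrow> ('v \<Rightarrow> real) \<Rightarrow> bool" where
  "C1_on_nbhd V C f \<longleftrightarrow>
     (\<exists>U. openin (top_of_set V) U \<and> C \<subseteq> U \<and>
          (\<forall>y\<in>U. \<exists>v. is_gradient V f y v) \<and> continuous_on U (gradient V f))"

definition gvec :: "('n \<Rightarrow> 'm \<Rightarrow> 'x \<Rightarrow> 'e) \<Rightarrow> 'n \<Rightarrow> 'x \<Rightarrow> 'e ^ 'm::finite" where
  "gvec g i a = (\<chi> j. g i j a)"

definition fsum :: "('m::finite \<Rightarrow> 'e \<Rightarrow> real) \<Rightarrow> 'e ^ 'm \<Rightarrow> real" where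
  "fsum f y = (\<Sum>j\<in>UNIV. f j (y $ j))"

definition aggregate ::
    "('n::finite \<Rightarrow> 'm::finite \<Rightarrow> 'x \<Rightarrow> 'e::real_vector) \<Rightarrow> ('n \<Rightarrow> 'x) \<Rightarrow> 'e ^ 'm" where
  "aggregate g x = (1 / real CARD('n)) *\<^sub>R (\<Sum>i\<in>UNIV. gvec g i (x i))"

definition cost ::
    "('n::finite \<Rightarrow> 'm::finite \<Rightarrow> 'x \<Rightarrow> 'e::real_vector) \<Rightarrow> ('m \<Rightarrow> 'e \<Rightarrow> real) \<Rightarrow> ('n \<Rightarrow> 'x) \<Rightarrow> real" where
  "cost g f x = fsum f (aggregate g x)"

definition P_delta :: "'x set \<Rightarrow> 'x pmf set" where
  "P_delta A = {p. finite (set_pmf p) \<and> set_pmf p \<subseteq> A}"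

text \<open>The integral of the vector-valued map \<^term>\<open>gvec g i\<close> is taken component by component.\<close>

definition expect_gvec ::
    "('n \<Rightarrow> 'm::finite \<Rightarrow> 'x \<Rightarrow> 'e::{real_inner,banach,second_countable_topology}) \<Rightarrow>
     'n \<Rightarrow> 'x pmf \<Rightarrow> 'e ^ 'm" where
  "expect_gvec g i p = (\<chi> j. measure_pmf.expectation p (g i j))"

definition rand_cost ::
    "('n::finite \<Rightarrow> 'm::finite \<Rightarrow> 'x \<Rightarrow> 'e::{real_inner,banach,second_countable_topology}) \<Rightarrow>
     ('m \<Rightarrow> 'e \<Rightarrow> real) \<Rightarrow> ('n \<Rightarrow> 'x pmf) \<Rightarrow> real" where
  "rand_cost g f \<mu> =
     fsum f ((1 / real CARD('n)) *\<^sub>R (\<Sum>i\<in>UNIV. expect_gvec g i (\<mu> i)))"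

definition rand_opt ::
    "('n::finite \<Rightarrow> 'x set) \<Rightarrow>
     ('n \<Rightarrow> 'm::finite \<Rightarrow> 'x \<Rightarrow> 'e::{real_inner,banach,second_countable_topology}) \<Rightarrow>
     ('m \<Rightarrow> 'e \<Rightarrow> real) \<Rightarrow> real" where
  "rand_opt X g f = (INF \<mu> \<in> (\<Pi> i\<in>UNIV. P_delta (X i)). rand_cost g f \<mu>)"

definition S_comp :: "('n \<Rightarrow> 'x set) \<Rightarrow> ('n \<Rightarrow> 'm \<Rightarrow> 'x \<Rightarrow> 'e) \<Rightarrow> 'n \<Rightarrow> 'm \<Rightarrow> 'e set" where
  "S_comp X g i j = g i j ` X i"

text \<open>The sum of sets below is the Minkowski sum.\<close>

definition S_sum ::
    "('n::finite \<Rightarrow> 'x set) \<Rightarrow> ('n \<Rightarrow> 'm \<Rightarrow> 'x \<Rightarrow> 'e::real_vector) \<Rightarrow> 'm \<Rightarrow> 'e set" where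
  "S_sum X g j = (\<lambda>s. (1 / real CARD('n)) *\<^sub>R s) ` (\<Sum>i\<in>UNIV. S_comp X g i j)"

definition diam_comp ::
    "('n \<Rightarrow> 'x set) \<Rightarrow> ('n \<Rightarrow> 'm \<Rightarrow> 'x \<Rightarrow> 'e::metric_space) \<Rightarrow> 'n \<Rightarrow> 'm \<Rightarrow> real" where
  "diam_comp X g i j = diameter (S_comp X g i j)"

definition assumption1 ::
    "('m::finite \<Rightarrow> 'e::real_inner set) \<Rightarrow> ('n::finite \<Rightarrow> 'x set) \<Rightarrow> ('n \<Rightarrow> 'm \<Rightarrow> 'x \<Rightarrow> 'e) \<Rightarrow>
     ('m \<Rightarrow> 'e \<Rightarrow> real) \<Rightarrow> ('m \<Rightarrow> real) \<Rightarrow> ('m \<Rightarrow> real) \<Rightarrow> bool" where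
  "assumption1 E X g f L L' \<longleftrightarrow>
     (\<forall>i j. bounded (S_comp X g i j)) \<and>
     (\<forall>j. (L j)-lipschitz_on (convex hull (S_sum X g j)) (f j)) \<and>
     (\<forall>j. C1_on_nbhd (E j) (convex hull (S_sum X g j)) (f j) \<and>
          (L' j)-lipschitz_on (convex hull (S_sum X g j)) (gradient (E j) (f j)))"

definition assumption2 ::
    "('n::finite \<Rightarrow> 'x set) \<Rightarrow> ('n \<Rightarrow> 'm::finite \<Rightarrow> 'x \<Rightarrow> 'e::real_vector) \<Rightarrow>
     ('m \<Rightarrow> 'e \<Rightarrow> real) \<Rightarrow> bool" where
  "assumption2 X g f \<longleftrightarrow> (\<forall>j. convex_on (convex hull (S_sum X g j)) (f j))"

definition grad_set ::
    "('m::finite \<Rightarrow> 'e::real_inner set) \<Rightarrow> ('n::finite \<Rightarrow> 'x set) \<Rightarrow> ('n \<Rightarrow> 'm \<Rightarrow> 'x \<Rightarrow> 'e) \<Rightarrow>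
     ('m \<Rightarrow> 'e \<Rightarrow> real) \<Rightarrow> ('e ^ 'm) set" where
  "grad_set E X g f =
     gradient (prod_space E) (fsum f) ` (convex hull (aggregate g ` (\<Pi> i\<in>UNIV. X i)))"

text \<open>Existence of solutions is expressed by the chosen selection \<open>sel i\<close> of solutions.\<close>

definition assumption3 ::
    "('m::finite \<Rightarrow> 'e::real_inner set) \<Rightarrow> ('n::finite \<Rightarrow> 'x set) \<Rightarrow> ('n \<Rightarrow> 'm \<Rightarrow> 'x \<Rightarrow> 'e) \<Rightarrow>
     ('m \<Rightarrow> 'e \<Rightarrow> real) \<Rightarrow> ('n \<Rightarrow> 'e ^ 'm \<Rightarrow> 'x) \<Rightarrow> bool" where
  "assumption3 E X g f sel \<longleftrightarrow>
     (\<forall>i. \<forall>l \<in> grad_set E X g f.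
        is_arg_min (\<lambda>a. inner l (gvec g i a)) (\<lambda>a. a \<in> X i) (sel i l))"

definition C0_const ::
    "('n::finite \<Rightarrow> 'x set) \<Rightarrow> ('n \<Rightarrow> 'm::finite \<Rightarrow> 'x \<Rightarrow> 'e::metric_space) \<Rightarrow> ('m \<Rightarrow> real) \<Rightarrow> real" where
  "C0_const X g L = (\<Sum>j\<in>UNIV. L j * (MAX i\<in>UNIV. diam_comp X g i j))"

definition C1_const ::
    "('n::finite \<Rightarrow> 'x set) \<Rightarrow> ('n \<Rightarrow> 'm::finite \<Rightarrow> 'x \<Rightarrow> 'e::metric_space) \<Rightarrow> ('m \<Rightarrow> real) \<Rightarrow> real" where
  "C1_const X g L' =
     1 / real CARD('n) * (\<Sum>j\<in>UNIV. L' j * (\<Sum>i\<in>UNIV. (diam_comp X g i j)\<^sup>2))"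

definition fw_step :: "nat \<Rightarrow> real" where
  "fw_step k = 2 / (real k + 2)"

text \<open>Here \<open>b i\<close> is the outcome of the Bernoulli draw of agent \<open>i\<close>, \<^const>\<open>True\<close> standing for 1.\<close>

definition fw_candidate ::
    "('m::finite \<Rightarrow> 'e::real_inner set) \<Rightarrow> ('n::finite \<Rightarrow> 'm \<Rightarrow> 'x \<Rightarrow> 'e) \<Rightarrow> ('m \<Rightarrow> 'e \<Rightarrow> real) \<Rightarrow>
     ('n \<Rightarrow> 'e ^ 'm \<Rightarrow> 'x) \<Rightarrow> ('n \<Rightarrow> 'x) \<Rightarrow> ('n \<Rightarrow> bool) \<Rightarrow> 'n \<Rightarrow> 'x" where
  "fw_candidate E g f sel x b =
     (let l = gradient (prod_space E) (fsum f) (aggregate g x)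
      in (\<lambda>i. if b i then sel i l else x i))"

text \<open>
  A realization \<open>x\<close> of the algorithm for given outcomes \<open>b k j i\<close> of the draws, where \<open>j\<close> runs
  from 1 to \<open>n k\<close>.
\<close>

definition fw_path ::
    "('m::finite \<Rightarrow> 'e::real_inner set) \<Rightarrow> ('n::finite \<Rightarrow> 'm \<Rightarrow> 'x \<Rightarrow> 'e) \<Rightarrow> ('m \<Rightarrow> 'e \<Rightarrow> real) \<Rightarrow>
     ('n \<Rightarrow> 'e ^ 'm \<Rightarrow> 'x) \<Rightarrow> ('n \<Rightarrow> 'x) \<Rightarrow> (nat \<Rightarrow> nat) \<Rightarrow> (nat \<Rightarrow> nat \<Rightarrow> 'n \<Rightarrow> bool) \<Rightarrow>
     (nat \<Rightarrow> 'n \<Rightarrow> 'x) \<Rightarrow> bool" where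
  "fw_path E g f sel x0 n b x \<longleftrightarrow>
     x 0 = x0 \<and>
     (\<forall>k. is_arg_min (cost g f)
            (\<lambda>z. z \<in> (\<lambda>j. fw_candidate E g f sel (x k) (b k j)) ` {1..n k}) (x (Suc k)))"

text \<open>
  The random process generated by the algorithm on the probability space \<open>Q\<close>.  The last conjunct
  says that \<open>x (Suc k)\<close> is a function of the draws up to iteration \<open>k\<close>, i.e. that ties
  are broken by a deterministic rule.
\<close>

definition stochastic_FW ::
    "'w measure \<Rightarrow> ('m::finite \<Rightarrow> 'e::real_inner set) \<Rightarrow> ('n::finite \<Rightarrow> 'm \<Rightarrow> 'x \<Rightarrow> 'e) \<Rightarrow>
     ('m \<Rightarrow> 'e \<Rightarrow> real) \<Rightarrow> ('n \<Rightarrow> 'e ^ 'm \<Rightarrow> 'x) \<Rightarrow> ('n \<Rightarrow> 'x) \<Rightarrow> (nat \<Rightarrow> nat) \<Rightarrow>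
     (nat \<Rightarrow> nat \<Rightarrow> 'n \<Rightarrow> 'w \<Rightarrow> bool) \<Rightarrow> (nat \<Rightarrow> 'w \<Rightarrow> 'n \<Rightarrow> 'x) \<Rightarrow> bool" where
  "stochastic_FW Q E g f sel x0 n P x \<longleftrightarrow>
     prob_space Q \<and>
     (\<forall>k. \<forall>j\<in>{1..n k}. \<forall>i.
        distr Q (count_space UNIV) (P k j i) = measure_pmf (bernoulli_pmf (fw_step k))) \<and>
     prob_space.indep_vars Q (\<lambda>_. count_space UNIV) (\<lambda>(k, j, i). P k j i)
       (SIGMA k:UNIV. {1..n k} \<times> UNIV) \<and>
     (\<forall>w\<in>space Q. fw_path E g f sel x0 n (\<lambda>k j i. P k j i w) (\<lambda>k. x k w)) \<and>
     (\<forall>k. \<forall>w\<in>space Q. \<forall>w'\<in>space Q.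
        (\<forall>k'\<le>k. \<forall>j\<in>{1..n k'}. \<forall>i. P k' j i w = P k' j i w') \<longrightarrow> x (Suc k) w = x (Suc k) w')"

end

theory Submission
  imports Defs
begin

text \<open>
  Write \<open>\<omega> = 2/(k+2)\<close> and \<open>\<gamma>\<^sub>k\<close> for the gap after \<open>k\<close> steps.  Smoothness of \<open>f\<close> at the mean of a
  candidate, together with the Frank-Wolfe gap estimate and the variance bound, shows that for
  \<open>k \<le> 2N\<close> the conditional expectation of the cost of a candidate exceeds the optimum by at most
  \<open>(1 - \<omega>) \<gamma>\<^sub>k + \<omega>\<^sup>2 C\<^sub>1\<close>.  Let \<open>Z\<^sub>k\<close> be the amount by which \<open>\<gamma>\<close> after the step exceeds this bound.
  Multiplying by \<open>(k+1)(k+2)\<close> and summing gives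
  \<open>K (K+1) \<gamma>\<^sub>K \<le> 4 C\<^sub>1 K + (\<Sum>k<K. (k+1)(k+2) Z\<^sub>k)\<close>.

  It remains to bound the probability that the last sum reaches \<open>C\<^sub>0 (K+1)\<close>.  Changing one draw changes
  the cost of a candidate by at most \<open>C\<^sub>0/N\<close>, and \<open>Z\<^sub>k\<close> is at most the average of the excesses of the
  \<open>n\<^sub>k\<close> candidates, so a Bernstein type estimate bounds the conditional moment generating function
  of \<open>Z\<^sub>k\<close>.  Chernoff's bound with parameter \<open>A / (6 C\<^sub>0 (K+1))\<close> then yields \<open>exp (- A / 9)\<close>.
\<close>

section \<open>Functions of independent Bernoulli variables\<close>

lemma exp_le_1_plus_x_plus_square:
  fixes x :: real
  assumes "x \<le> 1"
  shows "exp x \<le> 1 + x + x\<^sup>2"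
proof (cases "x \<ge> 0")
  case True
  then show ?thesis using assms by (rule exp_bound)
next
  case False
  define h :: "real \<Rightarrow> real" where "h = (\<lambda>t. 1 + t + t\<^sup>2 - exp t)"
  \<comment> \<open>For negative \<open>x\<close>, the function \<open>h\<close> decreases up to its
    zero at 0: its derivative 1 + 2t - exp t is at most t, because exp t \<ge> 1 + t.\<close>
  have "h x \<ge> h 0"
  proof (rule DERIV_nonpos_imp_nonincreasing[where f = h])
    show "x \<le> 0" using False by simp
    fix t :: real assume t: "x \<le> t" "t \<le> 0"
    have d: "DERIV h t :> 1 + 2 * t - exp t"
      unfolding h_def by (auto intro!: derivative_eq_intros)
    have "1 + 2 * t - exp t \<le> 0"
      using exp_ge_add_one_self[of t] t by linarith
    then show "\<exists>y. DERIV h t :> y \<and> y \<le> 0"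
      using d by blast
  qed
  then show ?thesis by (simp add: h_def)
qed

text \<open>After centring at the mean, the quadratic bound on exp is applied at both points. The
  linear terms cancel and the quadratic ones add up to p (1 - p) d^2. The alternative
  \<open>p = 1\<close> covers a draw that is certain, where no smallness of \<open>u\<close> is
  available; this happens at step 0, whose step size is 1.\<close>

lemma bernoulli_exp_bound:
  fixes p a b u :: real
  assumes p: "0 \<le> p" "p \<le> 1" and ab: "\<bar>a - b\<bar> \<le> u" and u: "u \<le> 1 \<or> p = 1"
  shows "p * exp a + (1 - p) * exp b \<le> exp (p * a + (1 - p) * b + p * (1 - p) * u\<^sup>2)"
proof (cases "p = 1")
  case True
  then show ?thesis by simp
next
  case False
  define d where "d = a - b"
  define m where "m = p * a + (1 - p) * b"
  have d: "\<bar>d\<bar> \<le> u" "\<bar>d\<bar> \<le> 1" using ab u False by (auto simp: d_def)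
  have a: "a = m + (1 - p) * d" and b: "b = m + - (p * d)"
    by (simp_all add: m_def d_def algebra_simps)
  have abs_le: "\<bar>q * d\<bar> \<le> 1" if "0 \<le> q" "q \<le> 1" for q
    using mult_mono[OF that(2) d(2)] that by (simp add: abs_mult)
  have 1: "exp ((1 - p) * d) \<le> 1 + (1 - p) * d + ((1 - p) * d)\<^sup>2"
    using abs_le[of "1 - p"] p by (intro exp_le_1_plus_x_plus_square) auto
  have 2: "exp (- (p * d)) \<le> 1 + - (p * d) + (- (p * d))\<^sup>2"
    using abs_le[of p] p by (intro exp_le_1_plus_x_plus_square) auto
  have "p * exp ((1 - p) * d) + (1 - p) * exp (- (p * d))
      \<le> p * (1 + (1 - p) * d + ((1 - p) * d)\<^sup>2) + (1 - p) * (1 + - (p * d) + (- (p * d))\<^sup>2)"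
    using 1 2 p by (intro add_mono mult_left_mono) auto
  also have "\<dots> = 1 + p * (1 - p) * d\<^sup>2"
    by (simp add: power2_eq_square algebra_simps)
  also have "\<dots> \<le> 1 + p * (1 - p) * u\<^sup>2"
  proof -
    have "d\<^sup>2 \<le> u\<^sup>2" using d(1) by (metis abs_ge_zero power2_abs power_mono)
    then show ?thesis using p by (intro add_left_mono mult_left_mono) auto
  qed
  also have "\<dots> \<le> exp (p * (1 - p) * u\<^sup>2)"
    using exp_ge_add_one_self by (simp add: add.commute)
  finally have *: "p * exp ((1 - p) * d) + (1 - p) * exp (- (p * d)) \<le> exp (p * (1 - p) * u\<^sup>2)" .
  have "p * exp a + (1 - p) * exp b = exp m * (p * exp ((1 - p) * d) + (1 - p) * exp (- (p * d)))"
    unfolding a b exp_add by (simp add: algebra_simps)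
  also have "\<dots> \<le> exp m * exp (p * (1 - p) * u\<^sup>2)"
    using * by (intro mult_left_mono) auto
  finally show ?thesis by (simp add: m_def exp_add)
qed

section \<open>Finitely supported product measures and their moments\<close>

lemma expectation_pair_pmf_finite:
  fixes h :: "'a \<times> 'b \<Rightarrow> real"
  assumes "finite (set_pmf p)" "finite (set_pmf q)"
  shows "measure_pmf.expectation (pair_pmf p q) h =
         measure_pmf.expectation p (\<lambda>a. measure_pmf.expectation q (\<lambda>b. h (a, b)))"
proof -
  have "measure_pmf.expectation (pair_pmf p q) h =
      (\<Sum>z\<in>set_pmf p \<times> set_pmf q. h z * pmf (pair_pmf p q) z)"
    using assms by (intro integral_measure_pmf_real) auto
  also have "\<dots> = (\<Sum>a\<in>set_pmf p. \<Sum>b\<in>set_pmf q. h (a, b) * pmf q b * pmf p a)"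
    by (auto simp: sum.cartesian_product pmf_pair algebra_simps intro!: sum.cong)
  also have "\<dots> = (\<Sum>a\<in>set_pmf p. (\<Sum>b\<in>set_pmf q. h (a, b) * pmf q b) * pmf p a)"
    by (simp add: sum_distrib_right)
  also have "\<dots> = (\<Sum>a\<in>set_pmf p. measure_pmf.expectation q (\<lambda>b. h (a, b)) * pmf p a)"
    using assms by (subst integral_measure_pmf_real[of "set_pmf q"]) auto
  also have "\<dots> = measure_pmf.expectation p (\<lambda>a. measure_pmf.expectation q (\<lambda>b. h (a, b)))"
    using assms by (intro integral_measure_pmf_real[symmetric]) auto
  finally show ?thesis .
qed

lemma finite_set_Pi_pmf:
  assumes "finite A" "\<And>x. x \<in> A \<Longrightarrow> finite (set_pmf (p x))"
  shows "finite (set_pmf (Pi_pmf A d p))"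
  using assms by (auto simp: set_Pi_pmf)

lemma expectation_mono_pmf:
  fixes h k :: "'a \<Rightarrow> real"
  assumes "finite (set_pmf p)" "\<And>a. a \<in> set_pmf p \<Longrightarrow> h a \<le> k a"
  shows "measure_pmf.expectation p h \<le> measure_pmf.expectation p k"
  using assms by (intro integral_mono_AE integrable_measure_pmf_finite) (auto simp: AE_measure_pmf_iff)

text \<open>
  A bounded difference inequality that keeps the variance factor \<open>\<omega> (1 - \<omega>)\<close>; the factor \<open>1/4\<close>
  of McDiarmid's inequality would be too weak for step sizes of order \<open>1/k\<close>.
\<close>

lemma bernoulli_product_mgf:
  fixes \<Psi> :: "('i \<Rightarrow> bool) \<Rightarrow> real" and \<omega> u :: "'i \<Rightarrow> real"
  assumes "finite I"
    and "\<And>i. i \<in> I \<Longrightarrow> 0 \<le> \<omega> i \<and> \<omega> i \<le> 1"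
    and "\<And>i. i \<in> I \<Longrightarrow> u i \<le> 1 \<or> \<omega> i = 1"
    and "\<And>i b. i \<in> I \<Longrightarrow> \<bar>\<Psi> (b(i := True)) - \<Psi> (b(i := False))\<bar> \<le> u i"
  defines "Pr \<equiv> Pi_pmf I False (\<lambda>i. bernoulli_pmf (\<omega> i))"
  shows "measure_pmf.expectation Pr (\<lambda>b. exp (\<Psi> b))
    \<le> exp (measure_pmf.expectation Pr \<Psi> + (\<Sum>i\<in>I. \<omega> i * (1 - \<omega> i) * (u i)\<^sup>2))"
  unfolding Pr_def using assms(1-4)
proof (induction I arbitrary: \<Psi> rule: finite_induct)
  case empty
  then show ?case by simp
next
  case (insert i I)
  define q where "q = Pi_pmf I False (\<lambda>i. bernoulli_pmf (\<omega> i))"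
  define \<sigma> where "\<sigma> = (\<Sum>i\<in>I. \<omega> i * (1 - \<omega> i) * (u i)\<^sup>2)"
  \<comment> \<open>\<open>M y\<close> is the conditional mean of \<Psi> given that draw
    \<open>i\<close> has outcome \<open>y\<close>.\<close>
  define M where "M = (\<lambda>y. measure_pmf.expectation q (\<lambda>b. \<Psi> (b(i := y))))"
  have fq: "finite (set_pmf q)"
    unfolding q_def using insert.hyps by (intro finite_set_Pi_pmf) (auto intro: finite_subset)
  have \<omega>: "0 \<le> \<omega> i" "\<omega> i \<le> 1" using insert.prems(1) by auto
  have E: "measure_pmf.expectation (Pi_pmf (insert i I) False (\<lambda>i. bernoulli_pmf (\<omega> i))) h
      = \<omega> i * measure_pmf.expectation q (\<lambda>b. h (b(i := True)))
        + (1 - \<omega> i) * measure_pmf.expectation q (\<lambda>b. h (b(i := False)))" for h :: "_ \<Rightarrow> real"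
    unfolding Pi_pmf_insert[OF insert.hyps] integral_map_pmf q_def[symmetric] case_prod_beta
    using \<omega> fq by (subst expectation_pair_pmf_finite) (auto intro: finite_subset)
  have IH: "measure_pmf.expectation q (\<lambda>b. exp (\<Psi> (b(i := y)))) \<le> exp (M y + \<sigma>)" for y
    unfolding q_def M_def \<sigma>_def
  proof (rule insert.IH)
    fix j b assume "j \<in> I"
    then have "j \<noteq> i" using insert.hyps by auto
    then have twist: "b(j := c, i := y) = (b(i := y))(j := c)" for c by (rule fun_upd_twist)
    then show "\<bar>\<Psi> (b(j := True, i := y)) - \<Psi> (b(j := False, i := y))\<bar> \<le> u j"
      using insert.prems(3)[of j "b(i := y)"] \<open>j \<in> I\<close> unfolding twist by blast
  qed (use insert.prems in auto)
  \<comment> \<open>Averaging over the other draws preserves the bounded difference, so the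
    two-point bound applies to the conditional means.\<close>
  have "\<bar>M True - M False\<bar> \<le> u i"
  proof -
    have "M True - M False = measure_pmf.expectation q (\<lambda>b. \<Psi> (b(i := True)) - \<Psi> (b(i := False)))"
      unfolding M_def using fq by (intro Bochner_Integration.integral_diff[symmetric] integrable_measure_pmf_finite)
    also have "\<bar>\<dots>\<bar> \<le> measure_pmf.expectation q (\<lambda>b. \<bar>\<Psi> (b(i := True)) - \<Psi> (b(i := False))\<bar>)"
      by (rule integral_abs_bound)
    also have "\<dots> \<le> measure_pmf.expectation q (\<lambda>b. u i)"
      using insert.prems(3) by (intro expectation_mono_pmf[OF fq]) blast
    finally show ?thesis by simp
  qed
  then have *: "\<omega> i * exp (M True) + (1 - \<omega> i) * exp (M False)
      \<le> exp (\<omega> i * M True + (1 - \<omega> i) * M False + \<omega> i * (1 - \<omega> i) * (u i)\<^sup>2)"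
    using \<omega> insert.prems(2)[of i] by (intro bernoulli_exp_bound) auto
  have "\<omega> i * measure_pmf.expectation q (\<lambda>b. exp (\<Psi> (b(i := True))))
        + (1 - \<omega> i) * measure_pmf.expectation q (\<lambda>b. exp (\<Psi> (b(i := False))))
      \<le> \<omega> i * exp (M True + \<sigma>) + (1 - \<omega> i) * exp (M False + \<sigma>)"
    using \<omega> IH by (intro add_mono mult_left_mono) auto
  also have "\<dots> = (\<omega> i * exp (M True) + (1 - \<omega> i) * exp (M False)) * exp \<sigma>"
    by (simp add: exp_add algebra_simps)
  also have "\<dots> \<le> exp (\<omega> i * M True + (1 - \<omega> i) * M False + \<omega> i * (1 - \<omega> i) * (u i)\<^sup>2) * exp \<sigma>"
    using * by (intro mult_right_mono) auto
  also have "\<dots> = exp (\<omega> i * M True + (1 - \<omega> i) * M False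
      + (\<Sum>i\<in>insert i I. \<omega> i * (1 - \<omega> i) * (u i)\<^sup>2))"
    using insert.hyps by (simp add: exp_add[symmetric] \<sigma>_def algebra_simps)
  finally show ?case
    unfolding E M_def .
qed

text \<open>These moments are all that the expected cost bound needs to know about the draws. The
  mixed moment factorizes by independence once it is written as a product over all of
  \<open>I\<close>, with factor 1 away from the two indices.\<close>

lemma bernoulli_product_moments:
  fixes \<omega> :: "'i \<Rightarrow> real"
  assumes "finite I" and \<omega>: "\<And>i. i \<in> I \<Longrightarrow> 0 \<le> \<omega> i \<and> \<omega> i \<le> 1"
  defines "Pr \<equiv> Pi_pmf I False (\<lambda>i. bernoulli_pmf (\<omega> i))"
  shows "i \<in> I \<Longrightarrow> measure_pmf.expectation Pr (\<lambda>b. of_bool (b i) - \<omega> i) = 0"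
    and "i \<in> I \<Longrightarrow> i' \<in> I \<Longrightarrow>
      measure_pmf.expectation Pr (\<lambda>b. (of_bool (b i) - \<omega> i) * (of_bool (b i') - \<omega> i'))
        = (if i = i' then \<omega> i * (1 - \<omega> i) else 0)"
proof -
  have fin: "finite (set_pmf Pr)"
    unfolding Pr_def using assms(1) by (intro finite_set_Pi_pmf) (auto intro: finite_subset)
  note int = integrable_measure_pmf_finite[OF fin]
  have comp: "measure_pmf.expectation Pr (\<lambda>b. h (b i)) = \<omega> i * h True + (1 - \<omega> i) * h False"
    if "i \<in> I" for i and h :: "bool \<Rightarrow> real"
  proof -
    have "measure_pmf.expectation Pr (\<lambda>b. h (b i)) = measure_pmf.expectation (map_pmf (\<lambda>b. b i) Pr) h"
      by simp
    also have "map_pmf (\<lambda>b. b i) Pr = bernoulli_pmf (\<omega> i)"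
      unfolding Pr_def using that assms(1) by (simp add: Pi_pmf_component)
    finally show ?thesis using \<omega>[OF that] by simp
  qed
  have pair: "measure_pmf.expectation Pr (\<lambda>b. of_bool (b i) * of_bool (b i')) = \<omega> i * \<omega> i'"
    if "i \<in> I" "i' \<in> I" "i \<noteq> i'" for i i'
  proof -
    let ?f = "\<lambda>k c. if k = i \<or> k = i' then of_bool c else (1 :: real)"
    have "(\<Prod>k\<in>I. ?f k (b k)) = of_bool (b i) * of_bool (b i')" for b
    proof -
      have "(\<Prod>k\<in>I. ?f k (b k)) = (\<Prod>k\<in>{i, i'}. ?f k (b k))"
        using that assms(1) by (intro prod.mono_neutral_right) auto
      then show ?thesis using that by simp
    qed
    then have "measure_pmf.expectation Pr (\<lambda>b. of_bool (b i) * of_bool (b i') :: real)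
        = measure_pmf.expectation Pr (\<lambda>b. \<Prod>k\<in>I. ?f k (b k))" by simp
    also have "\<dots> = (\<Prod>k\<in>I. measure_pmf.expectation (bernoulli_pmf (\<omega> k)) (?f k))"
      unfolding Pr_def using assms(1)
      by (intro expectation_prod_Pi_pmf) (auto intro!: integrable_measure_pmf_finite intro: finite_subset)
    also have "\<dots> = (\<Prod>k\<in>{i, i'}. measure_pmf.expectation (bernoulli_pmf (\<omega> k)) (?f k))"
      using that assms(1) by (intro prod.mono_neutral_right) auto
    also have "\<dots> = \<omega> i * \<omega> i'" using that \<omega> by simp
    finally show ?thesis .
  qed
  show "measure_pmf.expectation Pr (\<lambda>b. of_bool (b i) - \<omega> i) = 0" if "i \<in> I"
    using comp[OF that, of "\<lambda>c. of_bool c - \<omega> i"] by (simp add: algebra_simps)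
  show "measure_pmf.expectation Pr (\<lambda>b. (of_bool (b i) - \<omega> i) * (of_bool (b i') - \<omega> i'))
        = (if i = i' then \<omega> i * (1 - \<omega> i) else 0)" if "i \<in> I" "i' \<in> I"
  proof (cases "i = i'")
    case True
    then show ?thesis
      using comp[OF that(1), of "\<lambda>c. (of_bool c - \<omega> i) * (of_bool c - \<omega> i)"]
      by (simp add: algebra_simps)
  next
    case False
    have "measure_pmf.expectation Pr (\<lambda>b. (of_bool (b i) - \<omega> i) * (of_bool (b i') - \<omega> i'))
      = measure_pmf.expectation Pr (\<lambda>b. of_bool (b i) * of_bool (b i')
          + (- \<omega> i') * of_bool (b i) + (- \<omega> i) * of_bool (b i') + \<omega> i * \<omega> i')"
      by (intro Bochner_Integration.integral_cong) (auto simp: algebra_simps)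
    also have "\<dots> = 0"
      using False pair[OF that] comp[OF that(1), of of_bool] comp[OF that(2), of of_bool]
      by (simp add: int Bochner_Integration.integral_add integral_mult_right_zero)
    finally show ?thesis using False by simp
  qed
qed

text \<open>This carries events about finitely many draws from an abstract sample space to a
  finitely supported product pmf, where every set is measurable. By independence each single outcome
  has the product of its marginal probabilities, and an event is a finite disjoint union of
  outcomes.\<close>

lemma (in prob_space) prob_restrict_indep_vars:
  fixes Y :: "'i \<Rightarrow> 'a \<Rightarrow> bool" and q :: "'i \<Rightarrow> bool pmf"
  assumes ind: "indep_vars (\<lambda>_. count_space UNIV) Y J" and I: "finite I" "I \<subseteq> J"
    and law: "\<And>i. i \<in> I \<Longrightarrow> distr M (count_space UNIV) (Y i) = measure_pmf (q i)"
  defines "D \<equiv> \<lambda>w i. i \<in> I \<and> Y i w"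
  shows "prob {w \<in> space M. D w \<in> B} = measure_pmf.prob (Pi_pmf I False q) B"
proof -
  let ?R = "PiE_dflt I False (\<lambda>_. UNIV) :: ('i \<Rightarrow> bool) set"
  have meas: "Y i \<in> measurable M (count_space UNIV)" if "i \<in> I" for i
    using ind that I unfolding indep_vars_def by auto
  \<comment> \<open>The extra intersection with \<open>space M\<close> keeps the identity true for
    empty \<open>I\<close>, where the intersection over \<open>I\<close> is the whole type. This
    case occurs for the draws before step 0.\<close>
  have pre: "{w \<in> space M. D w = b} = (\<Inter>i\<in>I. Y i -` {b i} \<inter> space M) \<inter> space M" if "b \<in> ?R" for b
    using that by (auto simp: D_def PiE_dflt_def fun_eq_iff)
  have ev: "{w \<in> space M. D w = b} \<in> events" if "b \<in> ?R" for b
  proof (cases "I = {}")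
    case False
    then show ?thesis unfolding pre[OF that]
      using I measurable_sets[OF meas] by (intro sets.Int[OF sets.finite_INT sets.top]) auto
  qed (simp add: pre[OF that])
  have finR: "finite ?R" using I by (intro finite_PiE_dflt) auto
  have eq: "{w \<in> space M. D w \<in> B} = (\<Union>b\<in>B \<inter> ?R. {w \<in> space M. D w = b})"
    by (auto simp: D_def PiE_dflt_def)
  have single: "prob {w \<in> space M. D w = b} = pmf (Pi_pmf I False q) b" if "b \<in> ?R" for b
  proof -
    have "prob {w \<in> space M. D w = b} = (\<Prod>i\<in>I. prob (Y i -` {b i} \<inter> space M))"
    proof (cases "I = {}")
      case True
      then show ?thesis by (simp add: pre[OF that] prob_space)
    next
      case False
      then have "{w \<in> space M. D w = b} = (\<Inter>i\<in>I. Y i -` {b i} \<inter> space M)"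
        using pre[OF that] by auto
      then show ?thesis
        using indep_varsD[OF ind False I(1,2), of "\<lambda>i. {b i}"] by simp
    qed
    also have "\<dots> = (\<Prod>i\<in>I. pmf (q i) (b i))"
    proof (intro prod.cong refl)
      fix i assume i: "i \<in> I"
      have "prob (Y i -` {b i} \<inter> space M) = measure (distr M (count_space UNIV) (Y i)) {b i}"
        using meas[OF i] by (simp add: measure_distr)
      then show "prob (Y i -` {b i} \<inter> space M) = pmf (q i) (b i)"
        by (simp add: law[OF i] measure_pmf_single)
    qed
    also have "\<dots> = pmf (Pi_pmf I False q) b"
      using I that by (simp add: pmf_Pi' PiE_dflt_def)
    finally show ?thesis .
  qed
  have "prob {w \<in> space M. D w \<in> B} = (\<Sum>b\<in>B \<inter> ?R. prob {w \<in> space M. D w = b})"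
    unfolding eq using finR ev
    by (intro finite_measure_finite_Union) (auto simp: disjoint_family_on_def)
  also have "\<dots> = (\<Sum>b\<in>B \<inter> ?R. pmf (Pi_pmf I False q) b)"
    using single by simp
  also have "\<dots> = measure_pmf.prob (Pi_pmf I False q) (B \<inter> ?R)"
    using finR by (simp add: measure_measure_pmf_finite)
  also have "\<dots> = measure_pmf.prob (Pi_pmf I False q) B"
  proof -
    have "set_pmf (Pi_pmf I False q) \<subseteq> ?R"
      using set_Pi_pmf_subset[OF I(1), of False q] by (auto simp: PiE_dflt_def)
    then show ?thesis
      by (intro measure_pmf.finite_measure_eq_AE) (auto simp: AE_measure_pmf_iff)
  qed
  finally show "prob {w \<in> space M. D w \<in> B} = measure_pmf.prob (Pi_pmf I False q) B" .
qed

section \<open>Smooth convex functions and the Frank-Wolfe step\<close>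

text \<open>A line through \<open>y\<close> in direction \<open>h\<close> stays inside
  \<open>V\<close>, so a derivative relative to \<open>V\<close> yields an ordinary derivative in
  the real parameter. The smoothness and convexity estimates below thereby become one-variable
  calculus.\<close>

lemma is_gradient_line:
  assumes "subspace V" "y \<in> V" "h \<in> V" "is_gradient V f (y + t *\<^sub>R h) v"
  shows "((\<lambda>s. f (y + s *\<^sub>R h)) has_real_derivative inner h v) (at t)"
proof -
  have "((\<lambda>s. f (y + s *\<^sub>R h)) has_derivative (\<lambda>s. inner (s *\<^sub>R h) v)) (at t)"
  proof (rule has_derivative_in_compose[where g = f and f = "\<lambda>s. y + s *\<^sub>R h"])
    show "((\<lambda>s. y + s *\<^sub>R h) has_derivative (\<lambda>s. s *\<^sub>R h)) (at t)"
      by (auto intro!: derivative_eq_intros)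
    have "range (\<lambda>s. y + s *\<^sub>R h) \<subseteq> V"
      using assms by (auto intro!: subspace_add subspace_scale)
    then show "(f has_derivative (\<lambda>k. inner k v)) (at (y + t *\<^sub>R h) within range (\<lambda>s. y + s *\<^sub>R h))"
      using assms(4) unfolding is_gradient_def by (auto intro: has_derivative_subset)
  qed
  then show ?thesis
    by (simp add: has_field_derivative_def mult.commute[of _ "inner h v"])
qed

text \<open>The difference of two gradients is itself a direction in \<open>V\<close>; the
  derivative along it, computed with either gradient, forces its norm to vanish.\<close>

lemma is_gradient_unique:
  assumes V: "subspace V" "y \<in> V" and v: "is_gradient V f y v" "is_gradient V f y v'"
  shows "v = v'"
proof -
  have "v - v' \<in> V"
    using V v unfolding is_gradient_def by (auto intro: subspace_diff)
  then have "inner (v - v') v = inner (v - v') v'"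
    using is_gradient_line[OF V, of "v - v'" f 0] v by (auto intro: DERIV_unique)
  then have "inner (v - v') (v - v') = 0"
    by (simp add: inner_diff_right)
  then show ?thesis by simp
qed

lemma gradient_eqI:
  assumes "subspace V" "y \<in> V" "is_gradient V f y v"
  shows "gradient V f y = v"
  unfolding gradient_def using assms is_gradient_unique by (intro the_equality)

text \<open>The descent lemma. The function \<open>h\<close> compares \<open>f\<close> along the
  segment with the quadratic upper bound; by Cauchy-Schwarz and the Lipschitz bound on
  \<open>D\<close> its derivative is nonpositive on [0, 1].\<close>

lemma lipschitz_gradient_upper_bound:
  assumes V: "subspace V" "C \<subseteq> V" "convex C"
    and grad: "\<And>y. y \<in> C \<Longrightarrow> is_gradient V f y (D y)"
    and lip: "B-lipschitz_on C D" and yz: "y \<in> C" "z \<in> C"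
  shows "f z \<le> f y + inner (z - y) (D y) + B / 2 * (norm (z - y))\<^sup>2"
proof -
  define d where "d = z - y"
  define h where "h = (\<lambda>t. f (y + t *\<^sub>R d) - t * inner d (D y) - B / 2 * t\<^sup>2 * (norm d)\<^sup>2)"
  have dV: "y \<in> V" "d \<in> V" using V yz by (auto simp: d_def intro: subspace_diff)
  have "h 1 \<le> h 0"
  proof (rule DERIV_nonpos_imp_nonincreasing[where f = h])
    fix t :: real assume t: "0 \<le> t" "t \<le> 1"
    have "y + t *\<^sub>R d = (1 - t) *\<^sub>R y + t *\<^sub>R z"
      by (simp add: d_def algebra_simps)
    then have mem: "y + t *\<^sub>R d \<in> C"
      using convexD_alt[OF V(3) yz t] by simp
    have der: "DERIV h t :> inner d (D (y + t *\<^sub>R d)) - inner d (D y) - B * t * (norm d)\<^sup>2"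
      unfolding h_def
      by (rule derivative_eq_intros is_gradient_line[OF V(1) dV grad[OF mem]] refl)+ simp
    have "inner d (D (y + t *\<^sub>R d)) - inner d (D y) = inner d (D (y + t *\<^sub>R d) - D y)"
      by (simp add: inner_diff_right)
    also have "\<dots> \<le> norm d * norm (D (y + t *\<^sub>R d) - D y)"
      by (rule norm_cauchy_schwarz)
    also have "\<dots> \<le> norm d * (B * norm (t *\<^sub>R d))"
      using lipschitz_onD[OF lip mem yz(1)] by (intro mult_left_mono) (auto simp: dist_norm)
    also have "\<dots> = B * t * (norm d)\<^sup>2"
      using t by (simp add: power2_eq_square)
    finally show "\<exists>l. DERIV h t :> l \<and> l \<le> 0"
      using der by force
  qed simp
  then show ?thesis by (simp add: h_def d_def)
qed

text \<open>The gradient inequality, from a gradient at \<open>y\<close> alone. If it failed,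
  \<open>h\<close>, which is \<open>f\<close> on the segment minus the linear growth of its chord,
  would have positive derivative at 0 and rise above \<open>h 0\<close>, whereas convexity keeps it
  at or below \<open>h 0\<close>.\<close>

lemma convex_gradient_lower_bound:
  assumes V: "subspace V" "C \<subseteq> V" and conv: "convex_on C f"
    and grad: "is_gradient V f y v" and yz: "y \<in> C" "z \<in> C"
  shows "f y + inner (z - y) v \<le> f z"
proof (rule ccontr)
  assume *: "\<not> f y + inner (z - y) v \<le> f z"
  define d where "d = z - y"
  define h where "h = (\<lambda>t. f (y + t *\<^sub>R d) - t * (f z - f y))"
  have dV: "y \<in> V" "d \<in> V" using V yz by (auto simp: d_def intro: subspace_diff)
  have "((\<lambda>s. f (y + s *\<^sub>R d)) has_real_derivative inner d v) (at 0)"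
    using is_gradient_line[OF V(1) dV, of f 0] grad by simp
  then have "DERIV h 0 :> inner d v - (f z - f y)"
    unfolding h_def by (auto intro!: derivative_eq_intros)
  moreover have "inner d v - (f z - f y) > 0" using * by (simp add: d_def)
  ultimately obtain e where e: "e > 0" "\<And>t. 0 < t \<Longrightarrow> t < e \<Longrightarrow> h 0 < h (0 + t)"
    using DERIV_pos_inc_right by blast
  define t where "t = min (e / 2) 1"
  have t: "0 < t" "t < e" "t \<le> 1" using e(1) by (auto simp: t_def)
  have "y + t *\<^sub>R d = (1 - t) *\<^sub>R y + t *\<^sub>R z"
    by (simp add: d_def algebra_simps)
  then have "f (y + t *\<^sub>R d) \<le> (1 - t) * f y + t * f z"
    using convex_onD[OF conv, of t y z] t yz by simp
  then have "h t \<le> h 0" by (simp add: h_def algebra_simps)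
  then show False using e(2)[OF t(1,2)] by simp
qed

lemma norm_sum_square_le:
  fixes v :: "'i \<Rightarrow> 'a::real_normed_vector"
  shows "(norm (\<Sum>i\<in>I. v i))\<^sup>2 \<le> card I * (\<Sum>i\<in>I. (norm (v i))\<^sup>2)"
proof -
  have "(norm (\<Sum>i\<in>I. v i))\<^sup>2 \<le> (\<Sum>i\<in>I. norm (v i))\<^sup>2"
    by (intro power_mono norm_sum) auto
  also have "\<dots> \<le> (\<Sum>i\<in>I. (norm (v i))\<^sup>2) * card I"
    by (rule sum_squared_le_sum_of_squares)
  finally show ?thesis by (simp add: mult.commute)
qed

section \<open>Deterministic estimates for one Frank-Wolfe step\<close>

locale fw_problem =
  fixes E :: "'m::finite \<Rightarrow> 'e::{real_inner,banach,second_countable_topology} set"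
    and X :: "'n::finite \<Rightarrow> 'x set"
    and g :: "'n \<Rightarrow> 'm \<Rightarrow> 'x \<Rightarrow> 'e"
    and f :: "'m \<Rightarrow> 'e \<Rightarrow> real"
    and L L' :: "'m \<Rightarrow> real"
    and sel :: "'n \<Rightarrow> 'e ^ 'm \<Rightarrow> 'x"
  assumes hilbert: "\<And>j. hilbert_subspace (E j)"
    and X_nonempty: "\<And>i. X i \<noteq> {}"
    and g_maps: "\<And>i j. g i j \<in> X i \<rightarrow> E j"
    and a1: "assumption1 E X g f L L'"
    and a2: "assumption2 X g f"
    and a3: "assumption3 E X g f sel"
begin

abbreviation "\<C> j \<equiv> convex hull (S_sum X g j)"

abbreviation "grad \<equiv> gradient (prod_space E) (fsum f)"

abbreviation "opt \<equiv> rand_opt X g f"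

abbreviation "C0 \<equiv> C0_const X g L"

abbreviation "C1 \<equiv> C1_const X g L'"

lemma subspace_E: "subspace (E j)"
  using hilbert by (auto simp: hilbert_subspace_def)

lemma S_sum_alt: "S_sum X g j = {(1 / real CARD('n)) *\<^sub>R (\<Sum>i\<in>UNIV. s i) | s. \<forall>i. s i \<in> S_comp X g i j}"
  unfolding S_sum_def by (auto simp: set_sum_alt)

lemma conv_subset: "\<C> j \<subseteq> E j"
proof (rule hull_minimal)
  have "S_comp X g i j \<subseteq> E j" for i
    using g_maps by (auto simp: S_comp_def)
  then show "S_sum X g j \<subseteq> E j"
    unfolding S_sum_alt
    by (auto intro!: subspace_scale[OF subspace_E] subspace_sum[OF subspace_E])
qed (use subspace_E subspace_imp_convex in blast)

lemma aggregate_nth: "aggregate g x $ j = (1 / real CARD('n)) *\<^sub>R (\<Sum>i\<in>UNIV. g i j (x i))"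
  by (simp add: aggregate_def gvec_def)

lemma aggregate_mem:
  assumes "x \<in> (\<Pi> i\<in>UNIV. X i)"
  shows "aggregate g x $ j \<in> \<C> j"
proof (rule hull_inc)
  show "aggregate g x $ j \<in> S_sum X g j"
    unfolding S_sum_alt aggregate_nth using assms
    by (auto simp: S_comp_def Pi_iff intro!: exI[of _ "\<lambda>i. g i j (x i)"])
qed

lemma dist_le_diam:
  assumes "a \<in> X i" "b \<in> X i"
  shows "norm (g i j a - g i j b) \<le> diam_comp X g i j"
  using a1 assms diameter_bounded_bound[of "S_comp X g i j" "g i j a" "g i j b"]
  by (simp add: diam_comp_def assumption1_def S_comp_def dist_norm)

lemma L'_lipschitz: "(L' j)-lipschitz_on (\<C> j) (gradient (E j) (f j))"
  using a1 by (simp add: assumption1_def)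

lemma L_lipschitz: "(L j)-lipschitz_on (\<C> j) (f j)"
  using a1 by (simp add: assumption1_def)

lemma L_nonneg: "0 \<le> L j"
  using L_lipschitz lipschitz_on_nonneg by blast

lemma L'_nonneg: "0 \<le> L' j"
  using L'_lipschitz lipschitz_on_nonneg by blast

lemma is_gradient_comp:
  assumes "y \<in> \<C> j"
  shows "is_gradient (E j) (f j) y (gradient (E j) (f j) y)"
proof -
  obtain v where v: "is_gradient (E j) (f j) y v"
    using a1 assms unfolding assumption1_def C1_on_nbhd_def by blast
  then show ?thesis
    using gradient_eqI[OF subspace_E _ v] conv_subset assms by auto
qed

text \<open>The inner product of the product space sums over components, so the component gradients
  together represent the derivative and lie in \<open>prod_space E\<close>; uniqueness then
  identifies them with the gradient.\<close>

lemma gradient_fsum: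
  assumes "\<And>j. y $ j \<in> \<C> j"
  shows "grad y = (\<chi> j. gradient (E j) (f j) (y $ j))"
proof (rule gradient_eqI)
  show "subspace (prod_space E)"
    using subspace_E unfolding prod_space_def subspace_def by auto
  show "y \<in> prod_space E"
    using assms conv_subset by (auto simp: prod_space_def)
  let ?v = "\<chi> j. gradient (E j) (f j) (y $ j)"
  have "((\<lambda>z. f j (z $ j)) has_derivative (\<lambda>h. inner (h $ j) (?v $ j))) (at y within prod_space E)" for j
  proof (rule has_derivative_in_compose[where g = "f j" and f = "\<lambda>z. z $ j"])
    show "((\<lambda>z. z $ j) has_derivative (\<lambda>h. h $ j)) (at y within prod_space E)"
      by (rule bounded_linear.has_derivative[OF bounded_linear_vec_nth has_derivative_ident])
    show "(f j has_derivative (\<lambda>h. inner h (?v $ j))) (at (y $ j) within (\<lambda>z. z $ j) ` prod_space E)"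
      using is_gradient_comp[OF assms[of j]] unfolding is_gradient_def
      by (auto simp: prod_space_def intro: has_derivative_subset)
  qed
  then have "(fsum f has_derivative (\<lambda>h. \<Sum>j\<in>UNIV. inner (h $ j) (?v $ j))) (at y within prod_space E)"
    unfolding fsum_def by (intro has_derivative_sum)
  moreover have "?v \<in> prod_space E"
    using is_gradient_comp[OF assms] by (auto simp: is_gradient_def prod_space_def)
  ultimately show "is_gradient (prod_space E) (fsum f) y ?v"
    unfolding is_gradient_def inner_vec_def by simp
qed

text \<open>Applying the descent lemma in each component keeps the individual constants
  \<open>L' j\<close>, from which \<open>C1\<close> is built.\<close>

lemma fsum_upper_bound:
  assumes y: "\<And>j. y $ j \<in> \<C> j" and z: "\<And>j. z $ j \<in> \<C> j"
  shows "fsum f z \<le> fsum f y + inner (grad y) (z - y) + (\<Sum>j\<in>UNIV. L' j * (norm (z $ j - y $ j))\<^sup>2) / 2"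
proof -
  have "fsum f z \<le> (\<Sum>j\<in>UNIV. f j (y $ j) + inner (z $ j - y $ j) (gradient (E j) (f j) (y $ j))
      + L' j / 2 * (norm (z $ j - y $ j))\<^sup>2)"
    unfolding fsum_def using y z
    by (intro sum_mono lipschitz_gradient_upper_bound[OF subspace_E conv_subset convex_convex_hull
          is_gradient_comp L'_lipschitz]) auto
  also have "\<dots> = fsum f y + inner (grad y) (z - y) + (\<Sum>j\<in>UNIV. L' j * (norm (z $ j - y $ j))\<^sup>2) / 2"
    by (simp add: gradient_fsum[OF y] fsum_def inner_vec_def sum.distrib sum_divide_distrib inner_commute)
  finally show ?thesis .
qed

lemma fsum_lower_bound:
  assumes y: "\<And>j. y $ j \<in> \<C> j" and z: "\<And>j. z $ j \<in> \<C> j"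
  shows "fsum f y + inner (grad y) (z - y) \<le> fsum f z"
proof -
  have "fsum f y + inner (grad y) (z - y)
      = (\<Sum>j\<in>UNIV. f j (y $ j) + inner (z $ j - y $ j) (gradient (E j) (f j) (y $ j)))"
    by (simp add: gradient_fsum[OF y] fsum_def inner_vec_def sum.distrib inner_commute)
  also have "\<dots> \<le> fsum f z"
    unfolding fsum_def using y z a2 unfolding assumption2_def
    by (intro sum_mono convex_gradient_lower_bound[OF subspace_E conv_subset _ is_gradient_comp]) auto
  finally show ?thesis .
qed

lemma expectation_in_convex_hull:
  assumes "p \<in> P_delta (X i)"
  shows "measure_pmf.expectation p (g i j) \<in> convex hull (S_comp X g i j)"
proof -
  have p: "finite (set_pmf p)" "set_pmf p \<subseteq> X i" using assms by (auto simp: P_delta_def)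
  have "measure_pmf.expectation p (g i j) = (\<Sum>a\<in>set_pmf p. pmf p a *\<^sub>R g i j a)"
    using p by (intro integral_measure_pmf) auto
  also have "\<dots> \<in> convex hull (S_comp X g i j)"
    using p by (intro convex_sum) (auto simp: sum_pmf_eq_1 S_comp_def intro!: hull_inc)
  finally show ?thesis .
qed

text \<open>Convex hulls commute with Minkowski sums and scaling. Hence randomized aggregates stay
  in the region where the \<open>f j\<close> are convex.\<close>

lemma rand_aggregate_mem:
  assumes "\<mu> \<in> (\<Pi> i\<in>UNIV. P_delta (X i))"
  shows "((1 / real CARD('n)) *\<^sub>R (\<Sum>i\<in>UNIV. expect_gvec g i (\<mu> i))) $ j \<in> \<C> j"
proof -
  have "(\<Sum>i\<in>UNIV. measure_pmf.expectation (\<mu> i) (g i j)) \<in> (\<Sum>i\<in>UNIV. convex hull (S_comp X g i j))"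
    using assms expectation_in_convex_hull by (auto simp: set_sum_alt Pi_iff)
  then show ?thesis
    by (simp add: S_sum_def convex_hull_scaling convex_hull_set_sum expect_gvec_def)
qed

lemma is_arg_min_sel:
  assumes "x \<in> (\<Pi> i\<in>UNIV. X i)"
  defines "l \<equiv> grad (aggregate g x)"
  shows "sel i l \<in> X i" "a \<in> X i \<Longrightarrow> inner l (gvec g i (sel i l)) \<le> inner l (gvec g i a)"
proof -
  have "l \<in> grad_set E X g f"
    using assms by (auto simp: grad_set_def intro!: imageI hull_inc)
  then have "is_arg_min (\<lambda>a. inner l (gvec g i a)) (\<lambda>a. a \<in> X i) (sel i l)"
    using a3 by (auto simp: assumption3_def)
  then show "sel i l \<in> X i" "a \<in> X i \<Longrightarrow> inner l (gvec g i (sel i l)) \<le> inner l (gvec g i a)"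
    by (auto simp: is_arg_min_linorder)
qed

text \<open>By convexity the linearization at \<open>x\<close> bounds the cost from below at every
  randomized aggregate. Its average under each measure is at least its pointwise minimum, which
  \<open>sel\<close> attains, so the left side is below every \<open>rand_cost\<close> and therefore
  below the infimum.\<close>

lemma frank_wolfe_gap:
  assumes x: "x \<in> (\<Pi> i\<in>UNIV. X i)"
  defines "l \<equiv> grad (aggregate g x)"
  shows "cost g f x + inner l (aggregate g (\<lambda>i. sel i l) - aggregate g x) \<le> opt"
  unfolding rand_opt_def
proof (rule cINF_greatest)
  \<comment> \<open>Dirac measures show that the infimum ranges over a nonempty set.\<close>
  have "(\<lambda>i. return_pmf (SOME a. a \<in> X i)) \<in> (\<Pi> i\<in>UNIV. P_delta (X i))"
    using X_nonempty by (auto simp: P_delta_def some_in_eq)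
  then show "(\<Pi> i\<in>UNIV. P_delta (X i)) \<noteq> {}" by blast
next
  fix \<mu> assume \<mu>: "\<mu> \<in> (\<Pi> i\<in>UNIV. P_delta (X i))"
  let ?z = "(1 / real CARD('n)) *\<^sub>R (\<Sum>i\<in>UNIV. expect_gvec g i (\<mu> i))"
  have le: "inner l (gvec g i (sel i l)) \<le> inner l (expect_gvec g i (\<mu> i))" for i
  proof -
    have p: "finite (set_pmf (\<mu> i))" "set_pmf (\<mu> i) \<subseteq> X i"
      using \<mu> by (auto simp: P_delta_def Pi_iff)
    have "inner l (gvec g i (sel i l)) = (\<Sum>a\<in>set_pmf (\<mu> i). pmf (\<mu> i) a * inner l (gvec g i (sel i l)))"
      using p by (simp add: sum_distrib_right[symmetric] sum_pmf_eq_1)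
    also have "\<dots> \<le> (\<Sum>a\<in>set_pmf (\<mu> i). pmf (\<mu> i) a * inner l (gvec g i a))"
      unfolding l_def using p is_arg_min_sel(2)[OF x] by (intro sum_mono mult_left_mono) auto
    also have "\<dots> = inner l (\<Sum>a\<in>set_pmf (\<mu> i). pmf (\<mu> i) a *\<^sub>R gvec g i a)"
      by (simp add: inner_sum_right)
    also have "(\<Sum>a\<in>set_pmf (\<mu> i). pmf (\<mu> i) a *\<^sub>R gvec g i a) = expect_gvec g i (\<mu> i)"
    proof (rule vec_eq_iff[THEN iffD2, OF allI])
      fix j
      show "(\<Sum>a\<in>set_pmf (\<mu> i). pmf (\<mu> i) a *\<^sub>R gvec g i a) $ j = expect_gvec g i (\<mu> i) $ j"
        using p by (simp add: expect_gvec_def gvec_def integral_measure_pmf[of "set_pmf (\<mu> i)"])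
    qed
    finally show ?thesis .
  qed
  have "inner l (aggregate g (\<lambda>i. sel i l)) \<le> inner l ?z"
    using le by (auto simp: aggregate_def inner_sum_right intro!: divide_right_mono sum_mono)
  then have "cost g f x + inner l (aggregate g (\<lambda>i. sel i l) - aggregate g x)
      \<le> fsum f (aggregate g x) + inner l (?z - aggregate g x)"
    by (simp add: cost_def inner_diff_right)
  also have "\<dots> \<le> fsum f ?z"
    unfolding l_def by (intro fsum_lower_bound aggregate_mem x rand_aggregate_mem \<mu>)
  finally show "cost g f x + inner l (aggregate g (\<lambda>i. sel i l) - aggregate g x) \<le> rand_cost g f \<mu>"
    by (simp add: rand_cost_def)
qed

text \<open>Only summand \<open>i\<close> of the aggregate moves, in each component by at most its
  diameter over N. Passing to the largest diameter makes the bound independent of \<open>i\<close>,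
  which is the origin of \<open>C0\<close>.\<close>

lemma cost_bounded_difference:
  assumes x: "x \<in> (\<Pi> i\<in>UNIV. X i)" and x': "x' \<in> (\<Pi> i\<in>UNIV. X i)"
    and eq: "\<And>i'. i' \<noteq> i \<Longrightarrow> x i' = x' i'"
  shows "\<bar>cost g f x - cost g f x'\<bar> \<le> C0 / real CARD('n)"
proof -
  have "\<bar>cost g f x - cost g f x'\<bar> \<le> (\<Sum>j\<in>UNIV. \<bar>f j (aggregate g x $ j) - f j (aggregate g x' $ j)\<bar>)"
    unfolding cost_def fsum_def sum_subtractf[symmetric] by (rule sum_abs)
  also have "\<dots> \<le> (\<Sum>j\<in>UNIV. L j * (MAX i\<in>UNIV. diam_comp X g i j) / real CARD('n))"
  proof (rule sum_mono)
    fix j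
    have "(\<Sum>i'\<in>UNIV. g i' j (x i')) - (\<Sum>i'\<in>UNIV. g i' j (x' i')) = g i j (x i) - g i j (x' i)"
      unfolding sum_subtractf[symmetric] using eq by (subst sum.remove[of _ i]) auto
    then have "aggregate g x $ j - aggregate g x' $ j = (1 / real CARD('n)) *\<^sub>R (g i j (x i) - g i j (x' i))"
      by (simp add: aggregate_nth scaleR_diff_right[symmetric])
    then have "dist (aggregate g x $ j) (aggregate g x' $ j) = norm (g i j (x i) - g i j (x' i)) / real CARD('n)"
      by (simp add: dist_norm)
    also have "\<dots> \<le> (MAX i\<in>UNIV. diam_comp X g i j) / real CARD('n)"
    proof (rule divide_right_mono)
      have "norm (g i j (x i) - g i j (x' i)) \<le> diam_comp X g i j"
        using x x' by (intro dist_le_diam) auto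
      also have "\<dots> \<le> (MAX i\<in>UNIV. diam_comp X g i j)" by (intro Max_ge) auto
      finally show "norm (g i j (x i) - g i j (x' i)) \<le> (MAX i\<in>UNIV. diam_comp X g i j)" .
    qed simp
    finally have "L j * dist (aggregate g x $ j) (aggregate g x' $ j)
        \<le> L j * ((MAX i\<in>UNIV. diam_comp X g i j) / real CARD('n))"
      using L_nonneg by (intro mult_left_mono)
    moreover have "dist (f j (aggregate g x $ j)) (f j (aggregate g x' $ j))
        \<le> L j * dist (aggregate g x $ j) (aggregate g x' $ j)"
      using L_lipschitz aggregate_mem x x' by (intro lipschitz_onD) auto
    ultimately show "\<bar>f j (aggregate g x $ j) - f j (aggregate g x' $ j)\<bar>
        \<le> L j * (MAX i\<in>UNIV. diam_comp X g i j) / real CARD('n)"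
      by (simp add: dist_real_def)
  qed
  also have "\<dots> = C0 / real CARD('n)"
    by (simp add: C0_const_def sum_divide_distrib)
  finally show ?thesis .
qed

text \<open>The descent lemma is used twice: from the current aggregate to the mean \<open>e\<close>
  of the candidate's aggregate, and from \<open>e\<close> to the random aggregate. The first use
  gives the Frank-Wolfe progress and the \<omega>^2 term; the second adds only a variance, since its
  first-order term averages out. Stating it through two moments of \<open>\<beta>\<close> lets one
  candidate be treated on the pmf of its whole block.\<close>

lemma expected_cost_bound:
  fixes p :: "'b pmf" and \<beta> :: "'n \<Rightarrow> 'b \<Rightarrow> bool"
  assumes x: "x \<in> (\<Pi> i\<in>UNIV. X i)" and \<omega>: "0 \<le> \<omega>" "\<omega> \<le> 1"
    and fin: "finite (set_pmf p)"
    and m1: "\<And>i. measure_pmf.expectation p (\<lambda>b. of_bool (\<beta> i b) - \<omega>) = 0"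
    and m2: "\<And>i i'. measure_pmf.expectation p (\<lambda>b. (of_bool (\<beta> i b) - \<omega>) * (of_bool (\<beta> i' b) - \<omega>))
      = (if i = i' then \<omega> * (1 - \<omega>) else 0)"
  shows "measure_pmf.expectation p (\<lambda>b. cost g f (fw_candidate E g f sel x (\<lambda>i. \<beta> i b)))
    \<le> (1 - \<omega>) * cost g f x + \<omega> * opt + (\<omega>\<^sup>2 + \<omega> * (1 - \<omega>) / real CARD('n)) / 2 * C1"
proof -
  note int = integrable_measure_pmf_finite[OF fin]
  define y where "y = aggregate g x"
  define l where "l = grad y"
  define xb where "xb = (\<lambda>i. sel i l)"
  define e where "e = y + \<omega> *\<^sub>R (aggregate g xb - y)"
  define \<delta> where "\<delta> = (\<lambda>i. gvec g i (xb i) - gvec g i (x i))"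
  define c where "c = (\<lambda>b. fw_candidate E g f sel x (\<lambda>i. \<beta> i b))"
  define \<epsilon> where "\<epsilon> = (\<lambda>b i. of_bool (\<beta> i b) - \<omega>)"
  have xb: "xb \<in> (\<Pi> i\<in>UNIV. X i)"
    using is_arg_min_sel(1)[OF x] by (auto simp: xb_def l_def y_def)
  have c_eq: "c b = (\<lambda>i. if \<beta> i b then xb i else x i)" for b
    unfolding c_def fw_candidate_def xb_def l_def y_def Let_def ..
  have c: "c b \<in> (\<Pi> i\<in>UNIV. X i)" for b
    using x xb by (auto simp: c_eq Pi_iff)
  have ymem: "y $ j \<in> \<C> j" for j unfolding y_def by (rule aggregate_mem[OF x])
  have emem: "e $ j \<in> \<C> j" for j
  proof -
    have "e $ j = (1 - \<omega>) *\<^sub>R (y $ j) + \<omega> *\<^sub>R (aggregate g xb $ j)"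
      by (simp add: e_def algebra_simps)
    then show ?thesis
      using convexD_alt[OF convex_convex_hull ymem aggregate_mem[OF xb] \<omega>] by simp
  qed
  have diff: "aggregate g xb - y = (1 / real CARD('n)) *\<^sub>R (\<Sum>i\<in>UNIV. \<delta> i)"
    by (simp add: y_def aggregate_def \<delta>_def sum_subtractf scaleR_diff_right)
  have dev: "aggregate g (c b) - e = (1 / real CARD('n)) *\<^sub>R (\<Sum>i\<in>UNIV. \<epsilon> b i *\<^sub>R \<delta> i)" for b
  proof -
    have "aggregate g (c b) - y = (1 / real CARD('n)) *\<^sub>R (\<Sum>i\<in>UNIV. of_bool (\<beta> i b) *\<^sub>R \<delta> i)"
      unfolding y_def aggregate_def scaleR_diff_right[symmetric] sum_subtractf[symmetric]
      by (auto simp: c_eq \<delta>_def intro!: arg_cong[of _ _ "\<lambda>v. (1 / real CARD('n)) *\<^sub>R v"] sum.cong)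
    moreover have "e - y = (1 / real CARD('n)) *\<^sub>R (\<Sum>i\<in>UNIV. \<omega> *\<^sub>R \<delta> i)"
      by (simp add: e_def diff scaleR_sum_right[symmetric])
    ultimately have "(aggregate g (c b) - y) - (e - y)
        = (1 / real CARD('n)) *\<^sub>R (\<Sum>i\<in>UNIV. of_bool (\<beta> i b) *\<^sub>R \<delta> i - \<omega> *\<^sub>R \<delta> i)"
      by (simp add: scaleR_diff_right[symmetric] sum_subtractf)
    then show ?thesis by (simp add: \<epsilon>_def scaleR_diff_left)
  qed
  have \<delta>_le: "(norm (\<delta> i $ j))\<^sup>2 \<le> (diam_comp X g i j)\<^sup>2" for i j
    using x xb by (intro power_mono) (auto simp: \<delta>_def gvec_def intro!: dist_le_diam)
  define V where "V = (\<Sum>j\<in>UNIV. L' j * (\<Sum>i\<in>UNIV. (norm (\<delta> i $ j))\<^sup>2))"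
  have V_le: "V \<le> real CARD('n) * C1"
    unfolding V_def C1_const_def using \<delta>_le L'_nonneg
    by (auto intro!: sum_mono mult_left_mono)
  \<comment> \<open>The off-diagonal terms of the expanded square vanish because the centred draws
    are uncorrelated.\<close>
  have second: "measure_pmf.expectation p (\<lambda>b. (norm ((aggregate g (c b) - e) $ j))\<^sup>2)
      = \<omega> * (1 - \<omega>) / (real CARD('n))\<^sup>2 * (\<Sum>i\<in>UNIV. (norm (\<delta> i $ j))\<^sup>2)" for j
  proof -
    have "(norm ((aggregate g (c b) - e) $ j))\<^sup>2
        = (\<Sum>i\<in>UNIV. \<Sum>i'\<in>UNIV. inner (\<delta> i $ j) (\<delta> i' $ j) / (real CARD('n))\<^sup>2 * (\<epsilon> b i * \<epsilon> b i'))" for b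
      unfolding dev power2_norm_eq_inner
      by (simp add: inner_sum_left inner_sum_right sum_distrib_left sum_divide_distrib power2_eq_square
          mult_ac inner_commute)
    then have "measure_pmf.expectation p (\<lambda>b. (norm ((aggregate g (c b) - e) $ j))\<^sup>2)
        = (\<Sum>i\<in>UNIV. \<Sum>i'\<in>UNIV. inner (\<delta> i $ j) (\<delta> i' $ j) / (real CARD('n))\<^sup>2
            * measure_pmf.expectation p (\<lambda>b. \<epsilon> b i * \<epsilon> b i'))"
      by (simp add: Bochner_Integration.integral_sum int)
    also have "\<dots> = (\<Sum>i\<in>UNIV. \<Sum>i'\<in>UNIV. inner (\<delta> i $ j) (\<delta> i' $ j) / (real CARD('n))\<^sup>2
            * (if i = i' then \<omega> * (1 - \<omega>) else 0))"
      unfolding \<epsilon>_def m2 ..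
    also have "\<dots> = (\<Sum>i\<in>UNIV. inner (\<delta> i $ j) (\<delta> i $ j) / (real CARD('n))\<^sup>2 * (\<omega> * (1 - \<omega>)))"
      by (simp add: if_distrib[of "\<lambda>z. _ * z"] sum.delta cong: if_cong)
    also have "\<dots> = \<omega> * (1 - \<omega>) / (real CARD('n))\<^sup>2 * (\<Sum>i\<in>UNIV. (norm (\<delta> i $ j))\<^sup>2)"
      by (simp add: sum_distrib_left sum_divide_distrib power2_norm_eq_inner mult_ac)
    finally show ?thesis .
  qed
  have first: "measure_pmf.expectation p (\<lambda>b. inner (grad e) (aggregate g (c b) - e)) = 0"
  proof -
    have "inner (grad e) (aggregate g (c b) - e) = (\<Sum>i\<in>UNIV. inner (grad e) (\<delta> i) / real CARD('n) * \<epsilon> b i)" for b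
      unfolding dev by (simp add: inner_sum_right sum_divide_distrib mult_ac)
    then have "measure_pmf.expectation p (\<lambda>b. inner (grad e) (aggregate g (c b) - e))
        = (\<Sum>i\<in>UNIV. inner (grad e) (\<delta> i) / real CARD('n) * measure_pmf.expectation p (\<lambda>b. \<epsilon> b i))"
      by (simp add: Bochner_Integration.integral_sum int)
    then show ?thesis unfolding \<epsilon>_def m1 by simp
  qed
  have "measure_pmf.expectation p (\<lambda>b. cost g f (c b))
      \<le> measure_pmf.expectation p (\<lambda>b. fsum f e + inner (grad e) (aggregate g (c b) - e)
          + (\<Sum>j\<in>UNIV. L' j / 2 * (norm ((aggregate g (c b) - e) $ j))\<^sup>2))"
    unfolding cost_def
    using fsum_upper_bound[OF emem aggregate_mem[OF c]]
    by (intro expectation_mono_pmf[OF fin]) (simp add: sum_divide_distrib)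
  also have "\<dots> = fsum f e + (\<Sum>j\<in>UNIV. L' j / 2 * (\<omega> * (1 - \<omega>) / (real CARD('n))\<^sup>2 * (\<Sum>i\<in>UNIV. (norm (\<delta> i $ j))\<^sup>2)))"
    using first second
    by (simp add: Bochner_Integration.integral_add Bochner_Integration.integral_sum int
        mult.commute[of _ "2::real"] del: vector_minus_component)
  also have "\<dots> = fsum f e + \<omega> * (1 - \<omega>) / (real CARD('n))\<^sup>2 / 2 * V"
  proof -
    have "(\<Sum>j\<in>UNIV. L' j / 2 * (\<omega> * (1 - \<omega>) / (real CARD('n))\<^sup>2 * T j))
        = \<omega> * (1 - \<omega>) / (real CARD('n))\<^sup>2 / 2 * (\<Sum>j\<in>UNIV. L' j * T j)" for T
      unfolding sum_distrib_left by (rule sum.cong) (simp_all add: mult_ac)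
    then show ?thesis by (simp add: V_def)
  qed
  also have "fsum f e \<le> fsum f y + \<omega> * inner l (aggregate g xb - y) + \<omega>\<^sup>2 / (2 * real CARD('n)) * V"
  proof -
    \<comment> \<open>The square of an average is at most the average of the squares. Only one
      factor N is gained here, against two in the variance term.\<close>
    have "(norm ((aggregate g xb - y) $ j))\<^sup>2 \<le> (\<Sum>i\<in>UNIV. (norm (\<delta> i $ j))\<^sup>2) / real CARD('n)" for j
    proof -
      have "(norm ((aggregate g xb - y) $ j))\<^sup>2 = (norm (\<Sum>i\<in>UNIV. \<delta> i $ j))\<^sup>2 / (real CARD('n))\<^sup>2"
        unfolding diff by (simp add: power_divide)
      also have "\<dots> \<le> (real CARD('n) * (\<Sum>i\<in>UNIV. (norm (\<delta> i $ j))\<^sup>2)) / (real CARD('n))\<^sup>2"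
        by (intro divide_right_mono norm_sum_square_le) auto
      finally show ?thesis by (simp add: power2_eq_square)
    qed
    then have "(\<Sum>j\<in>UNIV. L' j * (norm ((aggregate g xb - y) $ j))\<^sup>2)
        \<le> (\<Sum>j\<in>UNIV. L' j * ((\<Sum>i\<in>UNIV. (norm (\<delta> i $ j))\<^sup>2) / real CARD('n)))"
      using L'_nonneg by (intro sum_mono mult_left_mono) auto
    also have "\<dots> = V / real CARD('n)" unfolding V_def sum_divide_distrib[of "\<lambda>j. L' j * _ j"] by simp
    finally have *: "(\<Sum>j\<in>UNIV. L' j * (norm ((aggregate g xb - y) $ j))\<^sup>2) \<le> V / real CARD('n)" .
    have "fsum f e \<le> fsum f y + inner l (e - y) + (\<Sum>j\<in>UNIV. L' j * (norm (e $ j - y $ j))\<^sup>2) / 2"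
      unfolding l_def by (rule fsum_upper_bound[OF ymem emem])
    also have "(\<Sum>j\<in>UNIV. L' j * (norm (e $ j - y $ j))\<^sup>2)
        = \<omega>\<^sup>2 * (\<Sum>j\<in>UNIV. L' j * (norm ((aggregate g xb - y) $ j))\<^sup>2)"
      by (simp add: e_def sum_distrib_left power_mult_distrib mult_ac)
    also have "\<dots> \<le> \<omega>\<^sup>2 * (V / real CARD('n))" using * by (intro mult_left_mono) auto
    finally show ?thesis by (simp add: e_def)
  qed
  also have "\<omega> * inner l (aggregate g xb - y) \<le> \<omega> * (opt - cost g f x)"
    using frank_wolfe_gap[OF x] \<omega> by (intro mult_left_mono) (auto simp: l_def y_def xb_def)
  also have "fsum f y + \<omega> * (opt - cost g f x) + \<omega>\<^sup>2 / (2 * real CARD('n)) * V + \<omega> * (1 - \<omega>) / (real CARD('n))\<^sup>2 / 2 * V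
      = (1 - \<omega>) * cost g f x + \<omega> * opt + (\<omega>\<^sup>2 + \<omega> * (1 - \<omega>) / real CARD('n)) / (2 * real CARD('n)) * V"
    by (simp add: y_def cost_def field_simps power2_eq_square)
  also have "\<dots> \<le> (1 - \<omega>) * cost g f x + \<omega> * opt + (\<omega>\<^sup>2 + \<omega> * (1 - \<omega>) / real CARD('n)) / (2 * real CARD('n)) * (real CARD('n) * C1)"
    using V_le \<omega> by (intro add_left_mono mult_left_mono) auto
  finally show ?thesis by (simp add: c_def)
qed

end

section \<open>Concentration along the random path\<close>

locale fw_process = fw_problem E X g f L L' sel + prob_space Q
  for E :: "'m::finite \<Rightarrow> 'e::{real_inner,banach,second_countable_topology} set"
    and X :: "'n::finite \<Rightarrow> 'x set"
    and g :: "'n \<Rightarrow> 'm \<Rightarrow> 'x \<Rightarrow> 'e"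
    and f :: "'m \<Rightarrow> 'e \<Rightarrow> real"
    and L L' :: "'m \<Rightarrow> real"
    and sel :: "'n \<Rightarrow> 'e ^ 'm \<Rightarrow> 'x"
    and Q :: "'w measure" +
  fixes x0 :: "'n \<Rightarrow> 'x"
    and n :: "nat \<Rightarrow> nat"
    and P :: "nat \<Rightarrow> nat \<Rightarrow> 'n \<Rightarrow> 'w \<Rightarrow> bool"
    and x :: "nat \<Rightarrow> 'w \<Rightarrow> 'n \<Rightarrow> 'x"
  assumes x0: "x0 \<in> (\<Pi> i\<in>UNIV. X i)"
    and n_pos: "\<And>k. 0 < n k"
    and fw: "stochastic_FW Q E g f sel x0 n P x"
begin

section \<open>The draws, and the iterates as functions of them\<close>

definition block :: "nat \<Rightarrow> (nat \<times> nat \<times> 'n) set" where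
  "block k = {k} \<times> {1..n k} \<times> UNIV"

definition past :: "nat \<Rightarrow> (nat \<times> nat \<times> 'n) set" where
  "past k = (SIGMA k':{..<k}. {1..n k'} \<times> UNIV)"

text \<open>The value False outside \<open>past k\<close> agrees with the default of
  \<open>past_pmf k\<close>, so that records of draws are comparable as total functions.\<close>

definition draws :: "nat \<Rightarrow> 'w \<Rightarrow> nat \<times> nat \<times> 'n \<Rightarrow> bool" where
  "draws k w = (\<lambda>e. e \<in> past k \<and> (\<lambda>(k, j, i). P k j i) e w)"

abbreviation "bern \<equiv> (\<lambda>e :: nat \<times> nat \<times> 'n. bernoulli_pmf (fw_step (fst e)))"

definition past_pmf :: "nat \<Rightarrow> (nat \<times> nat \<times> 'n \<Rightarrow> bool) pmf" where
  "past_pmf k = Pi_pmf (past k) False bern"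

definition block_pmf :: "nat \<Rightarrow> (nat \<times> nat \<times> 'n \<Rightarrow> bool) pmf" where
  "block_pmf k = Pi_pmf (block k) False bern"

text \<open>
  On outcomes of probability zero \<open>pick\<close> may be a junk value; on the support of \<open>past_pmf k\<close> it is
  a genuine realization of the draws.
\<close>

definition pick :: "nat \<Rightarrow> (nat \<times> nat \<times> 'n \<Rightarrow> bool) \<Rightarrow> 'w" where
  "pick k b = (SOME w. w \<in> space Q \<and> draws k w = b)"

lemma finite_past: "finite (past k)" and finite_block: "finite (block k)"
  by (auto simp: past_def block_def)

lemma past_Suc: "past (Suc k) = past k \<union> block k"
  by (auto simp: past_def block_def less_Suc_eq)

lemma past_block_disjoint: "past k \<inter> block k = {}"
  by (auto simp: past_def block_def)

lemma fw_step_bounds: "0 \<le> fw_step k" "fw_step k \<le> 1"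
  by (auto simp: fw_step_def)

lemma finite_set_past_pmf: "finite (set_pmf (past_pmf k))"
  unfolding past_pmf_def by (intro finite_set_Pi_pmf finite_past) (auto intro: finite_subset)

lemma finite_set_block_pmf: "finite (set_pmf (block_pmf k))"
  unfolding block_pmf_def by (intro finite_set_Pi_pmf finite_block) (auto intro: finite_subset)

lemma draws_law:
  "prob {w \<in> space Q. draws k w \<in> B} = measure_pmf.prob (past_pmf k) B"
proof -
  have ind: "indep_vars (\<lambda>_. count_space UNIV) (\<lambda>(k, j, i). P k j i) (SIGMA k:UNIV. {1..n k} \<times> UNIV)"
    using fw by (simp add: stochastic_FW_def)
  have sub: "past k \<subseteq> (SIGMA k:UNIV. {1..n k} \<times> UNIV)"
    by (auto simp: past_def)
  have law: "distr Q (count_space UNIV) ((\<lambda>(k, j, i). P k j i) e) = measure_pmf (bern e)" if "e \<in> past k" for e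
    using fw that by (auto simp: stochastic_FW_def past_def)
  show "prob {w \<in> space Q. draws k w \<in> B} = measure_pmf.prob (past_pmf k) B"
    unfolding draws_def past_pmf_def by (rule prob_restrict_indep_vars[OF ind finite_past sub law])
qed

lemma pick_draws:
  assumes "w \<in> space Q"
  shows "pick k (draws k w) \<in> space Q" "draws k (pick k (draws k w)) = draws k w"
  using someI_ex[of "\<lambda>w'. w' \<in> space Q \<and> draws k w' = draws k w"] assms
  unfolding pick_def by auto

text \<open>A record in the support has positive probability, so the event that it occurs is
  nonempty and contains a sample point to pick.\<close>

lemma pick_support:
  assumes "b \<in> set_pmf (past_pmf k)"
  shows "pick k b \<in> space Q" "draws k (pick k b) = b"
proof -
  have "prob {w \<in> space Q. draws k w \<in> {b}} = pmf (past_pmf k) b"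
    unfolding draws_law by (simp add: measure_pmf_single)
  also have "\<dots> > 0" using assms by (simp add: pmf_positive)
  finally have "{w \<in> space Q. draws k w \<in> {b}} \<noteq> {}" by (metis measure_empty less_irrefl)
  then show "pick k b \<in> space Q" "draws k (pick k b) = b"
    using pick_draws by auto
qed

lemma draws_mono:
  assumes "draws k w = draws k w'" "k' \<le> k"
  shows "draws k' w = draws k' w'"
proof
  fix e
  have "past k' \<subseteq> past k" using assms(2) by (auto simp: past_def)
  then show "draws k' w e = draws k' w' e"
    using fun_cong[OF assms(1), of e] by (auto simp: draws_def)
qed

lemma path: "w \<in> space Q \<Longrightarrow> fw_path E g f sel x0 n (\<lambda>k j i. P k j i w) (\<lambda>k. x k w)"
  using fw by (simp add: stochastic_FW_def)

lemma iterate_deterministic: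
  assumes w: "w \<in> space Q" "w' \<in> space Q" and eq: "draws k w = draws k w'"
  shows "x k w = x k w'"
proof (cases k)
  case 0
  then show ?thesis using path[OF w(1)] path[OF w(2)] by (simp add: fw_path_def)
next
  case (Suc m)
  \<comment> \<open>Since \<open>past (Suc m)\<close> stops at iteration \<open>m\<close>, it holds
    exactly the draws that determine \<open>x (Suc m)\<close>.\<close>
  have "P k' j i w = P k' j i w'" if "k' \<le> m" "j \<in> {1..n k'}" for k' j i
    using fun_cong[OF eq, of "(k', j, i)"] that Suc by (simp add: draws_def past_def)
  then show ?thesis using fw w unfolding stochastic_FW_def Suc by blast
qed

lemma candidate_mem:
  assumes "z \<in> (\<Pi> i\<in>UNIV. X i)"
  shows "fw_candidate E g f sel z b \<in> (\<Pi> i\<in>UNIV. X i)"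
  using assms is_arg_min_sel(1)[OF assms] by (auto simp: fw_candidate_def Let_def Pi_iff)

lemma next_iterate:
  assumes "w \<in> space Q"
  shows "x (Suc k) w \<in> (\<lambda>j. fw_candidate E g f sel (x k w) (\<lambda>i. P k j i w)) ` {1..n k}"
    and "j \<in> {1..n k} \<Longrightarrow> cost g f (x (Suc k) w) \<le> cost g f (fw_candidate E g f sel (x k w) (\<lambda>i. P k j i w))"
  using path[OF assms] by (auto simp: fw_path_def is_arg_min_linorder)

lemma iterate_mem:
  assumes "w \<in> space Q"
  shows "x k w \<in> (\<Pi> i\<in>UNIV. X i)"
proof (induction k)
  case 0
  then show ?case using path[OF assms] x0 by (simp add: fw_path_def)
next
  case (Suc k)
  obtain b where "x (Suc k) w = fw_candidate E g f sel (x k w) b"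
    using next_iterate(1)[OF assms, of k] by blast
  then show ?case using candidate_mem[OF Suc.IH] by simp
qed

section \<open>Telescoping the gap recursion\<close>

definition gap :: "nat \<Rightarrow> 'w \<Rightarrow> real" where
  "gap k w = cost g f (x k w) - opt"

text \<open>This is \<open>Z\<^sub>k\<close> of the overview.\<close>

definition excess :: "nat \<Rightarrow> 'w \<Rightarrow> real" where
  "excess k w = gap (Suc k) w - (1 - fw_step k) * gap k w - (fw_step k)\<^sup>2 * C1"

text \<open>
  Since \<open>weight k * (1 - fw_step k) = k * (k + 1)\<close>, the recursion for the gap telescopes.
\<close>

definition weight :: "nat \<Rightarrow> real" where
  "weight k = (real k + 1) * (real k + 2)"

definition weighted_excess :: "nat \<Rightarrow> 'w \<Rightarrow> real" where
  "weighted_excess K w = (\<Sum>k<K. weight k * excess k w)"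

text \<open>This is an identity, because \<open>excess\<close> records the exact discrepancy at each
  step. The factor 4 (k + 1) / (k + 2) is \<open>weight k\<close> times the squared step
  size.\<close>

lemma gap_unrolled:
  "real K * (real K + 1) * gap K w
     = 4 * C1 * (\<Sum>k<K. (real k + 1) / (real k + 2)) + weighted_excess K w"
proof (induction K)
  case 0
  then show ?case by (simp add: weighted_excess_def)
next
  case (Suc K)
  have w1: "weight K * (1 - fw_step K) = real K * (real K + 1)"
    by (simp add: weight_def fw_step_def field_simps)
  have w2: "weight K * (fw_step K)\<^sup>2 = 4 * ((real K + 1) / (real K + 2))"
  proof -
    have "(r - 1) * r * (2 / r)\<^sup>2 = 4 * ((r - 1) / r)" if "r > 0" for r :: real
      using that by (simp add: power2_eq_square)
    from this[of "real K + 2"] show ?thesis by (simp add: weight_def fw_step_def algebra_simps)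
  qed
  have "weight K * gap (Suc K) w = weight K * (1 - fw_step K) * gap K w
      + weight K * (fw_step K)\<^sup>2 * C1 + weight K * excess K w"
    by (simp add: excess_def algebra_simps)
  then show ?case
    unfolding w1 w2 using Suc.IH by (simp add: weight_def weighted_excess_def algebra_simps)
qed

lemma weighted_excess_deterministic:
  assumes "w \<in> space Q" "w' \<in> space Q" "draws k w = draws k w'"
  shows "weighted_excess k w = weighted_excess k w'"
proof -
  have "gap k' w = gap k' w'" if "k' \<le> k" for k'
    unfolding gap_def using iterate_deterministic[OF assms(1,2)] draws_mono[OF assms(3) that] by simp
  then show ?thesis unfolding weighted_excess_def excess_def by (intro sum.cong) auto
qed

section \<open>Comparison with the average of the candidates\<close>

definition mean_excess :: "nat \<Rightarrow> ('n \<Rightarrow> 'x) \<Rightarrow> (nat \<times> nat \<times> 'n \<Rightarrow> bool) \<Rightarrow> real" where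
  "mean_excess k z v =
     (\<Sum>j\<in>{1..n k}. cost g f (fw_candidate E g f sel z (\<lambda>i. v (k, j, i)))) / real (n k)
     - ((1 - fw_step k) * cost g f z + fw_step k * opt + (fw_step k)\<^sup>2 * C1)"

text \<open>
  Passing from the best candidate to the average of the candidates costs nothing here: the average
  already concentrates at the rate \<open>1 / n k\<close>, and its expectation is easy to bound.
\<close>

lemma excess_le_mean:
  assumes "w \<in> space Q" and v: "\<And>j i. j \<in> {1..n k} \<Longrightarrow> P k j i w = v (k, j, i)"
  shows "excess k w \<le> mean_excess k (x k w) v"
proof -
  have "real (n k) * cost g f (x (Suc k) w)
      \<le> (\<Sum>j\<in>{1..n k}. cost g f (fw_candidate E g f sel (x k w) (\<lambda>i. v (k, j, i))))"
  proof -
    have "(\<Sum>j\<in>{1..n k}. cost g f (x (Suc k) w))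
        \<le> (\<Sum>j\<in>{1..n k}. cost g f (fw_candidate E g f sel (x k w) (\<lambda>i. P k j i w)))"
      by (intro sum_mono next_iterate(2)[OF assms(1)])
    then show ?thesis using v by simp
  qed
  then have "cost g f (x (Suc k) w)
      \<le> (\<Sum>j\<in>{1..n k}. cost g f (fw_candidate E g f sel (x k w) (\<lambda>i. v (k, j, i)))) / real (n k)"
    using n_pos[of k] by (simp add: field_simps)
  then show ?thesis
    by (simp add: excess_def mean_excess_def gap_def algebra_simps)
qed

text \<open>With the iterate frozen at \<open>z\<close>, conditioning on the past becomes plain
  integration over \<open>block_pmf k\<close>, and every candidate satisfies the expected cost
  bound.\<close>

lemma expectation_mean_excess:
  assumes z: "z \<in> (\<Pi> i\<in>UNIV. X i)" and k: "k \<le> 2 * CARD('n)" and C1: "0 \<le> C1"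
  shows "measure_pmf.expectation (block_pmf k) (mean_excess k z) \<le> 0"
proof -
  let ?\<omega> = "fw_step k"
  let ?c = "\<lambda>j v. cost g f (fw_candidate E g f sel z (\<lambda>i. v (k, j, i)))"
  let ?B = "(1 - ?\<omega>) * cost g f z + ?\<omega> * opt + ?\<omega>\<^sup>2 * C1"
  note int = integrable_measure_pmf_finite[OF finite_set_block_pmf]
  have le: "measure_pmf.expectation (block_pmf k) (?c j) \<le> ?B" if j: "j \<in> {1..n k}" for j
  proof -
    have mem: "(k, j, i) \<in> block k" for i using j by (simp add: block_def)
    note mom = bernoulli_product_moments[OF finite_block, of k "\<lambda>e. fw_step (fst e)",
        folded block_pmf_def]
    have "measure_pmf.expectation (block_pmf k) (?c j)
      \<le> (1 - ?\<omega>) * cost g f z + ?\<omega> * opt + (?\<omega>\<^sup>2 + ?\<omega> * (1 - ?\<omega>) / real CARD('n)) / 2 * C1"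
    proof (rule expected_cost_bound[OF z fw_step_bounds finite_set_block_pmf])
      fix i i' :: 'n
      show "measure_pmf.expectation (block_pmf k) (\<lambda>b. of_bool (b (k, j, i)) - fw_step k) = 0"
        using mom(1)[OF _ mem[of i]] fw_step_bounds by simp
      show "measure_pmf.expectation (block_pmf k)
          (\<lambda>b. (of_bool (b (k, j, i)) - fw_step k) * (of_bool (b (k, j, i')) - fw_step k))
          = (if i = i' then fw_step k * (1 - fw_step k) else 0)"
        using mom(2)[OF _ mem[of i] mem[of i']] fw_step_bounds by simp
    qed
    also have "\<dots> \<le> ?B"
    proof -
      \<comment> \<open>The restriction k \<le> 2N enters here: 1 - \<omega> = k / (k + 2), and k /
        N \<le> 2. The variance contribution is thus no larger than \<omega>^2.\<close>
      have "(1 - ?\<omega>) / real CARD('n) \<le> ?\<omega>"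
      proof -
        have "1 - ?\<omega> = real k / (real k + 2)" by (simp add: fw_step_def field_simps)
        moreover have "real k / real CARD('n) \<le> 2"
          using of_nat_mono[OF k, where ?'a = real] by (simp add: divide_le_eq)
        ultimately show ?thesis
          using divide_right_mono[of "real k / real CARD('n)" 2 "real k + 2"]
          by (simp add: fw_step_def mult.commute)
      qed
      then have "?\<omega> * ((1 - ?\<omega>) / real CARD('n)) \<le> ?\<omega> * ?\<omega>"
        using fw_step_bounds by (intro mult_left_mono)
      then have "(?\<omega>\<^sup>2 + ?\<omega> * (1 - ?\<omega>) / real CARD('n)) / 2 \<le> ?\<omega>\<^sup>2"
        by (simp add: power2_eq_square)
      then show ?thesis using C1 by (intro add_left_mono mult_right_mono)
    qed
    finally show ?thesis .
  qed
  have "measure_pmf.expectation (block_pmf k) (mean_excess k z)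
      = (\<Sum>j\<in>{1..n k}. measure_pmf.expectation (block_pmf k) (?c j)) / real (n k) - ?B"
    unfolding mean_excess_def
    by (simp add: Bochner_Integration.integral_diff Bochner_Integration.integral_sum int)
  also have "(\<Sum>j\<in>{1..n k}. measure_pmf.expectation (block_pmf k) (?c j)) \<le> (\<Sum>j\<in>{1..n k}. ?B)"
    using le by (intro sum_mono)
  then have "(\<Sum>j\<in>{1..n k}. measure_pmf.expectation (block_pmf k) (?c j)) / real (n k) - ?B \<le> 0"
    using n_pos[of k] by (simp add: field_simps)
  finally show ?thesis .
qed

text \<open>A draw influences only its own candidate, so averaging over \<open>n k\<close>
  candidates divides the single-candidate bound by \<open>n k\<close>.\<close>

lemma mean_excess_difference:
  assumes z: "z \<in> (\<Pi> i\<in>UNIV. X i)" and e: "e \<in> block k"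
  shows "\<bar>mean_excess k z (v(e := True)) - mean_excess k z (v(e := False))\<bar>
    \<le> C0 / (real CARD('n) * real (n k))"
proof -
  obtain j i where e: "e = (k, j, i)" "j \<in> {1..n k}" using e by (auto simp: block_def)
  let ?c = "\<lambda>j v. cost g f (fw_candidate E g f sel z (\<lambda>i. v (k, j, i)))"
  have "(\<Sum>j\<in>{1..n k}. ?c j (v(e := True))) - (\<Sum>j\<in>{1..n k}. ?c j (v(e := False)))
      = ?c j (v(e := True)) - ?c j (v(e := False))"
    unfolding sum_subtractf[symmetric] using e by (subst sum.remove[of _ j]) (auto intro: sum.neutral)
  then have "mean_excess k z (v(e := True)) - mean_excess k z (v(e := False))
      = (?c j (v(e := True)) - ?c j (v(e := False))) / real (n k)"
    by (simp add: mean_excess_def diff_divide_distrib[symmetric])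
  moreover have "\<bar>?c j (v(e := True)) - ?c j (v(e := False))\<bar> \<le> C0 / real CARD('n)"
    by (rule cost_bounded_difference[OF candidate_mem[OF z] candidate_mem[OF z], of i])
       (simp add: fw_candidate_def e)
  ultimately show ?thesis
    using divide_right_mono[of _ "C0 / real CARD('n)" "real (n k)"]
    by (simp only: abs_divide) (simp add: divide_divide_eq_left)
qed

section \<open>Exponential moments of the weighted excess\<close>

definition width :: "real \<Rightarrow> nat \<Rightarrow> real" where
  "width s k = s * weight k * C0 / (real CARD('n) * real (n k))"

text \<open>The Bernstein variance proxy of a block, with one equal contribution from each of its N
  \<open>n k\<close> draws.\<close>

definition variance_term :: "real \<Rightarrow> nat \<Rightarrow> real" where
  "variance_term s k = real CARD('n) * real (n k) * (fw_step k * (1 - fw_step k) * (width s k)\<^sup>2)"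

lemma block_mgf:
  assumes z: "z \<in> (\<Pi> i\<in>UNIV. X i)" and k: "k \<le> 2 * CARD('n)" and C1: "0 \<le> C1"
    and s: "0 \<le> s" and u: "width s k \<le> 1 \<or> k = 0"
  shows "measure_pmf.expectation (block_pmf k) (\<lambda>v. exp (s * weight k * mean_excess k z v))
    \<le> exp (variance_term s k)"
proof -
  have w: "0 \<le> weight k" by (simp add: weight_def)
  have "measure_pmf.expectation (block_pmf k) (\<lambda>v. exp (s * weight k * mean_excess k z v))
    \<le> exp (measure_pmf.expectation (block_pmf k) (\<lambda>v. s * weight k * mean_excess k z v)
        + (\<Sum>e\<in>block k. fw_step (fst e) * (1 - fw_step (fst e)) * (width s k)\<^sup>2))"
    unfolding block_pmf_def
  proof (rule bernoulli_product_mgf[OF finite_block])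
    fix e v assume e: "e \<in> block k"
    have "\<bar>s * weight k * mean_excess k z (v(e := True)) - s * weight k * mean_excess k z (v(e := False))\<bar>
        = s * weight k * \<bar>mean_excess k z (v(e := True)) - mean_excess k z (v(e := False))\<bar>"
      using s w by (simp add: right_diff_distrib[symmetric] abs_mult)
    also have "\<dots> \<le> s * weight k * (C0 / (real CARD('n) * real (n k)))"
      using s w by (intro mult_left_mono mean_excess_difference[OF z e]) auto
    finally show "\<bar>s * weight k * mean_excess k z (v(e := True))
        - s * weight k * mean_excess k z (v(e := False))\<bar> \<le> width s k"
      by (simp add: width_def)
  next
    \<comment> \<open>At k = 0 the step size is 1, so the draws are certain and \<open>width\<close>
      may be large.\<close>
    fix e assume "e \<in> block k"
    then show "width s k \<le> 1 \<or> fw_step (fst e) = 1"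
      using u by (auto simp: block_def fw_step_def)
  qed (use fw_step_bounds in auto)
  also have "(\<Sum>e\<in>block k. fw_step (fst e) * (1 - fw_step (fst e)) * (width s k)\<^sup>2) = variance_term s k"
  proof -
    have "(\<Sum>e\<in>block k. fw_step (fst e) * (1 - fw_step (fst e)) * (width s k)\<^sup>2)
        = (\<Sum>e\<in>block k. fw_step k * (1 - fw_step k) * (width s k)\<^sup>2)"
      by (intro sum.cong) (auto simp: block_def)
    also have "\<dots> = variance_term s k"
      by (simp add: variance_term_def block_def card_cartesian_product mult_ac)
    finally show ?thesis .
  qed
  also have "measure_pmf.expectation (block_pmf k) (\<lambda>v. s * weight k * mean_excess k z v) \<le> 0"
    using expectation_mean_excess[OF z k C1] s w by (simp add: mult_nonneg_nonpos)
  finally show ?thesis by simp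
qed

text \<open>A supermartingale argument by induction. The record up to step k splits into independent
  parts, the past and the current block; for a fixed past the iterate is frozen and
  \<open>block_mgf\<close> bounds the new factor.\<close>

lemma weighted_excess_mgf:
  assumes C1: "0 \<le> C1" and s: "0 \<le> s"
    and K: "\<And>k. k < K \<Longrightarrow> k \<le> 2 * CARD('n)"
    and u: "\<And>k. k < K \<Longrightarrow> width s k \<le> 1 \<or> k = 0"
  shows "measure_pmf.expectation (past_pmf K) (\<lambda>b. exp (s * weighted_excess K (pick K b)))
    \<le> exp (\<Sum>k<K. variance_term s k)"
  using K u
proof (induction K)
  case 0
  then show ?case by (simp add: weighted_excess_def)
next
  case (Suc k)
  let ?merge = "\<lambda>(b, v) e. if e \<in> past k then b e else v e"
  have pr: "past_pmf (Suc k) = map_pmf ?merge (pair_pmf (past_pmf k) (block_pmf k))"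
    unfolding past_pmf_def block_pmf_def past_Suc
    by (rule Pi_pmf_union[OF finite_past finite_block past_block_disjoint])
  have step: "exp (s * weighted_excess (Suc k) (pick (Suc k) (?merge (b, v))))
      \<le> exp (s * weighted_excess k (pick k b)) * exp (s * weight k * mean_excess k (x k (pick k b)) v)"
    if b: "b \<in> set_pmf (past_pmf k)" and v: "v \<in> set_pmf (block_pmf k)" for b v
  proof -
    define m where "m = ?merge (b, v)"
    define w where "w = pick (Suc k) m"
    have "m \<in> set_pmf (past_pmf (Suc k))"
      unfolding pr m_def using b v by (auto simp del: split_paired_All split_paired_Ex)
    then have w: "w \<in> space Q" "draws (Suc k) w = m"
      using pick_support by (auto simp: w_def)
    have w0: "pick k b \<in> space Q" "draws k (pick k b) = b"
      using pick_support[OF b] by auto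
    \<comment> \<open>The points picked for the merged record and for \<open>b\<close> may differ,
      but they share the draws before step k and therefore the same iterate and the same earlier
      excesses.\<close>
    have "draws k w = b"
    proof
      fix e
      have "draws k w e = (e \<in> past k \<and> draws (Suc k) w e)"
        by (auto simp: draws_def past_Suc)
      also have "\<dots> = (e \<in> past k \<and> b e)" by (auto simp: w(2) m_def)
      also have "\<dots> = b e" by (subst (1 2) w0(2)[symmetric]) (auto simp: draws_def)
      finally show "draws k w e = b e" .
    qed
    then have dr: "draws k w = draws k (pick k b)" using w0 by simp
    have "P k j i w = v (k, j, i)" if "j \<in> {1..n k}" for j i
      using fun_cong[OF w(2), of "(k, j, i)"] that by (simp add: draws_def m_def past_def)
    then have "excess k w \<le> mean_excess k (x k w) v"
      by (intro excess_le_mean w(1))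
    then have "weight k * excess k w \<le> weight k * mean_excess k (x k (pick k b)) v"
      using iterate_deterministic[OF w(1) w0(1) dr] by (intro mult_left_mono) (auto simp: weight_def)
    then have "weighted_excess (Suc k) w \<le> weighted_excess k (pick k b) + weight k * mean_excess k (x k (pick k b)) v"
      using weighted_excess_deterministic[OF w(1) w0(1) dr] by (simp add: weighted_excess_def)
    then have "s * weighted_excess (Suc k) w \<le> s * weighted_excess k (pick k b) + s * weight k * mean_excess k (x k (pick k b)) v"
      using mult_left_mono[OF _ s] by (fastforce simp: algebra_simps)
    then show ?thesis unfolding w_def m_def by (simp add: exp_add[symmetric])
  qed
  have "measure_pmf.expectation (past_pmf (Suc k)) (\<lambda>b. exp (s * weighted_excess (Suc k) (pick (Suc k) b)))
      = measure_pmf.expectation (past_pmf k) (\<lambda>b. measure_pmf.expectation (block_pmf k)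
          (\<lambda>v. exp (s * weighted_excess (Suc k) (pick (Suc k) (?merge (b, v))))))"
    unfolding pr integral_map_pmf
    by (rule expectation_pair_pmf_finite[OF finite_set_past_pmf finite_set_block_pmf])
  also have "\<dots> \<le> measure_pmf.expectation (past_pmf k)
      (\<lambda>b. exp (s * weighted_excess k (pick k b)) * exp (variance_term s k))"
  proof (rule expectation_mono_pmf[OF finite_set_past_pmf])
    fix b assume b: "b \<in> set_pmf (past_pmf k)"
    have "measure_pmf.expectation (block_pmf k)
          (\<lambda>v. exp (s * weighted_excess (Suc k) (pick (Suc k) (?merge (b, v)))))
        \<le> measure_pmf.expectation (block_pmf k)
          (\<lambda>v. exp (s * weighted_excess k (pick k b)) * exp (s * weight k * mean_excess k (x k (pick k b)) v))"
      using step[OF b] by (intro expectation_mono_pmf[OF finite_set_block_pmf])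
    also have "\<dots> = exp (s * weighted_excess k (pick k b))
        * measure_pmf.expectation (block_pmf k) (\<lambda>v. exp (s * weight k * mean_excess k (x k (pick k b)) v))"
      by simp
    also have "\<dots> \<le> exp (s * weighted_excess k (pick k b)) * exp (variance_term s k)"
      using Suc.prems iterate_mem[OF pick_support(1)[OF b]] C1 s
      by (intro mult_left_mono block_mgf) auto
    finally show "measure_pmf.expectation (block_pmf k)
          (\<lambda>v. exp (s * weighted_excess (Suc k) (pick (Suc k) (?merge (b, v)))))
        \<le> exp (s * weighted_excess k (pick k b)) * exp (variance_term s k)" .
  qed
  also have "\<dots> = measure_pmf.expectation (past_pmf k) (\<lambda>b. exp (s * weighted_excess k (pick k b))) * exp (variance_term s k)"
    by simp
  also have "\<dots> \<le> exp (\<Sum>k<k. variance_term s k) * exp (variance_term s k)"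
    using Suc by (intro mult_right_mono) auto
  finally show ?case by (simp add: exp_add)
qed

section \<open>Tail bound and choice of the parameters\<close>

lemma weighted_excess_chernoff:
  assumes "0 \<le> C1" "0 \<le> s"
    and "\<And>k. k < K \<Longrightarrow> k \<le> 2 * CARD('n)"
    and "\<And>k. k < K \<Longrightarrow> width s k \<le> 1 \<or> k = 0"
  shows "measure_pmf.prob (past_pmf K) {b. t \<le> weighted_excess K (pick K b)}
    \<le> exp ((\<Sum>k<K. variance_term s k) - s * t)"
proof -
  have "measure_pmf.prob (past_pmf K) {b. t \<le> weighted_excess K (pick K b)}
      = measure_pmf.expectation (past_pmf K) (indicator {b. t \<le> weighted_excess K (pick K b)})"
    by simp
  also have "\<dots> \<le> measure_pmf.expectation (past_pmf K) (\<lambda>b. exp (- (s * t)) * exp (s * weighted_excess K (pick K b)))"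
    using mult_left_mono[OF _ assms(2), of t]
    by (intro expectation_mono_pmf[OF finite_set_past_pmf])
       (auto simp: exp_add[symmetric] split: split_indicator)
  also have "\<dots> = exp (- (s * t)) * measure_pmf.expectation (past_pmf K) (\<lambda>b. exp (s * weighted_excess K (pick K b)))"
    by simp
  also have "\<dots> \<le> exp (- (s * t)) * exp (\<Sum>k<K. variance_term s k)"
    using weighted_excess_mgf[OF assms] by (intro mult_left_mono) auto
  finally show ?thesis by (simp add: exp_add[symmetric] exp_diff exp_minus field_simps)
qed

text \<open>The gap after K steps depends on the sample point only through \<open>draws K\<close>,
  so its event can be evaluated under \<open>past_pmf K\<close>.\<close>

lemma prob_gap_less:
  assumes "\<And>w. w \<in> space Q \<Longrightarrow> weighted_excess K w < t \<Longrightarrow> gap K w < \<epsilon>"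
  shows "1 - measure_pmf.prob (past_pmf K) {b. t \<le> weighted_excess K (pick K b)} \<le> prob {w \<in> space Q. gap K w < \<epsilon>}"
proof -
  have "gap K (pick K (draws K w)) = gap K w" if "w \<in> space Q" for w
    unfolding gap_def using iterate_deterministic[OF pick_draws(1)[OF that] that pick_draws(2)[OF that]]
    by simp
  then have eq: "{w \<in> space Q. gap K w < \<epsilon>} = {w \<in> space Q. draws K w \<in> {b. gap K (pick K b) < \<epsilon>}}"
    by auto
  have "1 - measure_pmf.prob (past_pmf K) {b. t \<le> weighted_excess K (pick K b)}
      = measure_pmf.prob (past_pmf K) (UNIV - {b. t \<le> weighted_excess K (pick K b)})"
    using measure_pmf.prob_compl[of "{b. t \<le> weighted_excess K (pick K b)}" "past_pmf K"] by simp
  also have "\<dots> \<le> measure_pmf.prob (past_pmf K) {b. gap K (pick K b) < \<epsilon>}"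
    using assms pick_support(1) by (intro measure_pmf.finite_measure_mono_AE) (auto simp: AE_measure_pmf_iff not_le)
  also have "\<dots> = prob {w \<in> space Q. gap K w < \<epsilon>}"
    unfolding eq draws_law ..
  finally show ?thesis .
qed

text \<open>The factor 1 / \<open>C0\<close> in \<open>s\<close> cancels \<open>C0\<close> in
  \<open>width\<close>, and N \<open>n k\<close> \<ge> A k^2 absorbs the quadratic growth of
  \<open>weight\<close>. What remains of the variance grows only linearly in k, so its sum over k <
  K is of the order of A.\<close>

lemma width_variance_bounds:
  fixes A :: real and k K :: nat
  assumes C0: "C0 > 0" and A: "A > 0" and nk: "A * (real k)\<^sup>2 / real CARD('n) \<le> real (n k)" and k: "k > 0"
  defines "s \<equiv> A / (6 * C0 * (real K + 1))"
  shows "width s k \<le> 1"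
    and "variance_term s k \<le> A * (real k + 3) / (18 * (real K + 1)\<^sup>2)"
proof -
  define d where "d = real CARD('n) * real (n k)"
  have d: "d \<ge> A * (real k)\<^sup>2" using nk by (simp add: d_def field_simps)
  have pos: "0 < A * (real k)\<^sup>2" using A k by simp
  then have d0: "d > 0" using d by linarith
  have w: "width s k = A * (real k + 1) * (real k + 2) / (6 * (real K + 1) * d)"
    using C0 by (simp add: width_def s_def weight_def d_def mult_ac)
  have k1: "real k \<ge> 1" using k by simp
  \<comment> \<open>For k \<ge> 1 the factors are at most 2k and 3k; the resulting 6 is matched by
    the 6 in \<open>s\<close>.\<close>
  have "(real k + 1) * (real k + 2) \<le> (2 * real k) * (3 * real k)"
    using k1 by (intro mult_mono) auto
  also have "\<dots> \<le> 6 * (real K + 1) * (real k)\<^sup>2"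
    by (simp add: power2_eq_square algebra_simps)
  finally have "A * ((real k + 1) * (real k + 2)) \<le> A * (6 * (real K + 1) * (real k)\<^sup>2)"
    using A by (intro mult_left_mono) auto
  also have "\<dots> = 6 * (real K + 1) * (A * (real k)\<^sup>2)" by simp
  also have "\<dots> \<le> 6 * (real K + 1) * d" using d by (intro mult_left_mono) auto
  finally show "width s k \<le> 1"
    unfolding w using d0 by (simp add: divide_le_eq mult_ac)
  have step: "fw_step k * (1 - fw_step k) = 2 * real k / (real k + 2)\<^sup>2"
  proof -
    have "2 / r * (1 - 2 / r) = 2 * (r - 2) / r\<^sup>2" if "r > 0" for r :: real
      using that by (simp add: power2_eq_square field_simps)
    from this[of "real k + 2"] show ?thesis by (simp add: fw_step_def)
  qed
  have "variance_term s k = d * (2 * real k / (real k + 2)\<^sup>2) * (width s k)\<^sup>2"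
    unfolding variance_term_def step by (simp add: d_def)
  also have "\<dots> = A\<^sup>2 * (2 * real k * (real k + 1)\<^sup>2) / (36 * (real K + 1)\<^sup>2) / d"
  proof -
    have aux: "d * (2 * a / r\<^sup>2) * (A * b * r / (6 * q * d))\<^sup>2 = A\<^sup>2 * (2 * a * b\<^sup>2) / (36 * q\<^sup>2) / d"
      if "r > 0" for a b r q :: real
      using that d0 by (simp add: power2_eq_square)
    show ?thesis unfolding w by (rule aux) simp
  qed
  also have "\<dots> \<le> A\<^sup>2 * (2 * real k * (real k + 1)\<^sup>2) / (36 * (real K + 1)\<^sup>2) / (A * (real k)\<^sup>2)"
    using d pos d0 by (intro divide_left_mono) auto
  also have "\<dots> = A * ((real k + 1)\<^sup>2 / real k) / (18 * (real K + 1)\<^sup>2)"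
    using A k1 by (simp add: power2_eq_square)
  also have "\<dots> \<le> A * (real k + 3) / (18 * (real K + 1)\<^sup>2)"
  proof -
    have "(real k + 1)\<^sup>2 / real k \<le> real k + 3"
      using k1 by (simp add: divide_le_eq power2_eq_square algebra_simps)
    then show ?thesis using A by (intro divide_right_mono mult_left_mono) auto
  qed
  finally show "variance_term s k \<le> A * (real k + 3) / (18 * (real K + 1)\<^sup>2)" .
qed

lemma gap_probability_bound:
  assumes C0: "C0 > 0" and C1: "C1 > 0" and A: "A > 0"
    and nk: "\<And>k. A * (real k)\<^sup>2 / real CARD('n) \<le> real (n k)"
    and K: "K \<in> {1..2 * CARD('n)}"
  shows "1 - exp (- A / 12) \<le> prob {w \<in> space Q. gap K w < (4 * C1 + C0) / real K}"
proof -
  define s where "s = A / (6 * C0 * (real K + 1))"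
  \<comment> \<open>With this threshold a factor K + 1 can be cancelled from the unrolled recursion,
    leaving \<open>C0\<close> next to 4 \<open>C1\<close>.\<close>
  define t where "t = C0 * (real K + 1)"
  have K1: "real K \<ge> 1" using K by simp
  have var: "(\<Sum>k<K. variance_term s k) \<le> A / 18"
  proof -
    have "variance_term s k \<le> A * (real k + 3) / (18 * (real K + 1)\<^sup>2)" for k
    proof (cases "k = 0")
      \<comment> \<open>The lower bound on \<open>n 0\<close> carries no factor A, but the draws at
        step 0 are certain and have no variance.\<close>
      case True
      then show ?thesis using A by (simp add: variance_term_def fw_step_def)
    next
      case False
      then show ?thesis unfolding s_def using width_variance_bounds(2)[OF C0 A nk] by simp
    qed
    then have "(\<Sum>k<K. variance_term s k) \<le> (\<Sum>k<K. A * (real k + 3) / (18 * (real K + 1)\<^sup>2))"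
      by (intro sum_mono)
    also have "\<dots> = A / (18 * (real K + 1)\<^sup>2) * (\<Sum>k<K. real k + 3)"
      unfolding sum_distrib_left by simp
    also have "(\<Sum>k<K. real k + 3) = real K * (real K + 5) / 2"
      by (induction K) (auto simp: field_simps)
    also have "A / (18 * (real K + 1)\<^sup>2) * (real K * (real K + 5) / 2)
        \<le> A / (18 * (real K + 1)\<^sup>2) * (real K + 1)\<^sup>2"
    proof (rule mult_left_mono)
      \<comment> \<open>The difference (K + 1)^2 - K (K + 5) / 2 equals K (K - 1) / 2 + 1.\<close>
      have "0 \<le> real K * (real K - 1)" using K1 by simp
      then show "real K * (real K + 5) / 2 \<le> (real K + 1)\<^sup>2"
        by (simp add: power2_eq_square algebra_simps)
    qed (use A in auto)
    also have "\<dots> = A / 18" by simp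
    finally show ?thesis .
  qed
  have "measure_pmf.prob (past_pmf K) {b. t \<le> weighted_excess K (pick K b)}
      \<le> exp ((\<Sum>k<K. variance_term s k) - s * t)"
  proof (rule weighted_excess_chernoff)
    show "width s k \<le> 1 \<or> k = 0" for k
      unfolding s_def using width_variance_bounds(1)[OF C0 A nk] by blast
  qed (use C0 C1 A K in \<open>auto simp: s_def\<close>)
  also have "s * t = A / 6"
  proof -
    have "A / (6 * c * q) * (c * q) = A / 6" if "c > 0" "q > 0" for c q :: real
      using that by simp
    from this[OF C0, of "real K + 1"] show ?thesis by (simp only: s_def t_def)
  qed
  \<comment> \<open>The exponent is at most A / 18 - A / 6 = - A / 9, which is below - A /
    12.\<close>
  also have "exp ((\<Sum>k<K. variance_term s k) - A / 6) \<le> exp (- A / 12)"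
    using var A by simp
  finally have tail: "measure_pmf.prob (past_pmf K) {b. t \<le> weighted_excess K (pick K b)} \<le> exp (- A / 12)" .
  have "gap K w < (4 * C1 + C0) / real K" if "weighted_excess K w < t" for w
  proof -
    have "(\<Sum>k<K. (real k + 1) / (real k + 2)) \<le> (\<Sum>k<K. 1)"
      by (intro sum_mono) simp
    then have "4 * C1 * (\<Sum>k<K. (real k + 1) / (real k + 2)) \<le> 4 * C1 * real K"
      using C1 by (intro mult_left_mono) auto
    also have "\<dots> \<le> 4 * C1 * (real K + 1)" using C1 by simp
    finally have "real K * (real K + 1) * gap K w < (4 * C1 + C0) * (real K + 1)"
      using gap_unrolled[of K w] that by (simp add: t_def algebra_simps)
    then have "(real K * gap K w) * (real K + 1) < (4 * C1 + C0) * (real K + 1)"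
      by (simp add: mult_ac)
    then have "real K * gap K w < 4 * C1 + C0"
      by (simp add: mult_less_cancel_right)
    then show ?thesis using K1 by (simp add: less_divide_eq mult.commute)
  qed
  then have "1 - measure_pmf.prob (past_pmf K) {b. t \<le> weighted_excess K (pick K b)}
      \<le> prob {w \<in> space Q. gap K w < (4 * C1 + C0) / real K}"
    by (intro prob_gap_less)
  then show ?thesis using tail by linarith
qed

end

theorem corollary3p8:
  fixes E :: "'m::finite \<Rightarrow> 'e::{real_inner,banach,second_countable_topology} set"
    and X :: "'n::finite \<Rightarrow> 'x set"
    and g :: "'n \<Rightarrow> 'm \<Rightarrow> 'x \<Rightarrow> 'e"
    and f :: "'m \<Rightarrow> 'e \<Rightarrow> real"
    and L L' :: "'m \<Rightarrow> real"
    and sel :: "'n \<Rightarrow> 'e ^ 'm \<Rightarrow> 'x"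
    and x0 :: "'n \<Rightarrow> 'x"
    and n :: "nat \<Rightarrow> nat"
    and Q :: "'w measure"
    and P :: "nat \<Rightarrow> nat \<Rightarrow> 'n \<Rightarrow> 'w \<Rightarrow> bool"
    and x :: "nat \<Rightarrow> 'w \<Rightarrow> 'n \<Rightarrow> 'x"
    and A :: real
    and K :: nat
  assumes "\<And>j. hilbert_subspace (E j)"
    and "\<And>i. X i \<noteq> {}"
    and "\<And>i j. g i j \<in> X i \<rightarrow> E j"
    and "assumption1 E X g f L L'"
    and "assumption2 X g f"
    and "assumption3 E X g f sel"
    and "C0_const X g L > 0"
    and "C1_const X g L' > 0"
    and "A > 0"
    and "x0 \<in> (\<Pi> i\<in>UNIV. X i)"
    and "\<And>k. real (n k) \<ge> max (A * (real k)\<^sup>2 / real CARD('n)) 1"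
    and "stochastic_FW Q E g f sel x0 n P x"
    and "K \<in> {1..2 * CARD('n)}"
  shows "measure Q {w \<in> space Q. cost g f (x K w) - rand_opt X g f
           < (4 * C1_const X g L' + C0_const X g L) / real K} \<ge> 1 - exp (- A / 12)"
proof -
  interpret prob_space Q using assms(12) by (simp add: stochastic_FW_def)
  have n: "A * (real k)\<^sup>2 / real CARD('n) \<le> real (n k)" "0 < n k" for k
    using assms(11)[of k] by auto
  interpret fw_process E X g f L L' sel Q x0 n P x
    by unfold_locales (use assms n in auto)
  show ?thesis
    using gap_probability_bound[OF assms(7,8,9) n(1) assms(13)] unfolding gap_def .
qed

end
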